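(* Let $\gamma_1,\gamma_2,\nu,\lambda,\mu,\beta_1,\beta_2$ be smooth functions on a domain $\mathcal D\subset\mathbb{R}^2$ (coordinates $(u,v)$) such that, setting $$\sqrt E:=\frac{\mu_u}{\mu(2\gamma_2+\beta_1)},\qquad \sqrt G:=\frac{\mu_v}{\mu(2\gamma_1+\beta_2)},$$ we have $\sqrt E>0$, $\sqrt G>0$ on $\mathcal D$ (in particular the denominators and $\mu,\mu_u,\mu_v$ do not vanish), and $$\begin{aligned} &-\gamma_1\sqrt E\sqrt G=(\sqrt E)_v,\qquad -\gamma_2\sqrt E\sqrt G=(\sqrt G)_u,\\ &2\lambda\mu=\tfrac1{\sqrt E}(\gamma_2)_u+\tfrac1{\sqrt G}(\gamma_1)_v-(\gamma_1^2+\gamma_2^2),\\ &2\lambda\gamma_2-2\nu\gamma_1-\lambda\beta_1+(1+\nu)\beta_2=\tfrac1{\sqrt E}\lambda_u-\tfrac1{\sqrt G}\nu_v,\\ &2\lambda\gamma_1+2\nu\gamma_2+(1-\nu)\beta_1-\lambda\beta_2=\tfrac1{\sqrt E}\nu_u+\tfrac1{\sqrt G}\lambda_v,\\ &\gamma_1\beta_1-\gamma_2\beta_2+2\nu\mu=-\tfrac1{\sqrt E}(\beta_2)_u+\tfrac1{\sqrt G}(\beta_1)_v. \end{aligned}$$ Let $(u_0,v_0)\in\mathcal D$, $p_0\in\mathbb{R}^4_1$, and let $x_0,y_0,(n_1)_0,(n_2)_0$ be vectors in $\mathbb{R}^4_1$ with $\langle x_0,x_0\rangle=\langle y_0,y_0\rangle=1$,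 $\langle x_0,y_0\rangle=0$, $\langle(n_1)_0,(n_1)_0\rangle=\langle(n_2)_0,(n_2)_0\rangle=0$, $\langle(n_1)_0,(n_2)_0\rangle=-1$ (and $(n_1)_0,(n_2)_0$ orthogonal to $x_0,y_0$). Then there exist a subdomain $\mathcal D_0\subset\mathcal D$ containing $(u_0,v_0)$ and a unique marginally trapped surface $M^2:z=z(u,v)$, $(u,v)\in\mathcal D_0$, free of flat points, with $z(u_0,v_0)=p_0$, such that $\langle z_u,z_u\rangle=E$, $\langle z_v,z_v\rangle=G$, $\langle z_u,z_v\rangle=0$, the fields $x=z_u/\sqrt E$, $y=z_v/\sqrt G$ together with suitable normal fields $n_1,n_2$ form a geometric frame field of $M^2$ equal to $\{x_0,y_0,(n_1)_0,(n_2)_0\}$ at $(u_0,v_0)$, and $\gamma_1,\gamma_2,\nu,\lambda,\mu,\beta_1,\beta_2$ are the geometric functions of $M^2$ with respect to this frame, i.e. the derivative formulas $\nabla'_xx=\gamma_1y+(1+\nu)n_1$, $\nabla'_xy=-\gamma_1x+\lambda n_1+\mu n_2$, $\nabla'_yx=-\gamma_2y+\lambda n_1+\mu n_2$, $\nabla'_yy=\gamma_2x+(1-\nu)n_1$, $\nabla'_xn_1=\mu y+\beta_1n_1$, $\nabla'_yn_1=\mu x+\beta_2n_1$, $\nabla'_xn_2=(1+\nu)x+\lambda y-\beta_1n_2$, $\nabla'_yn_2=\lambda x+(1-\nu)y-\beta_2n_2$ hold.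
   Context: $\mathbb{R}^4_1$ is $\mathbb{R}^4$ with the metric $\langle\cdot,\cdot\rangle=dx_1^2+dx_2^2+dx_3^2-dx_4^2$ and Levi-Civita connection $\nabla'$ (the flat derivative). A surface $M^2\subset\mathbb{R}^4_1$ is spacelike if the induced metric is positive definite. For tangent fields $X,Y$, $\nabla'_XY=\nabla_XY+\sigma(X,Y)$ defines the second fundamental form $\sigma$; the mean curvature vector is $H=\frac12(\sigma(e,e)+\sigma(e',e'))$ for any orthonormal tangent frame $\{e,e'\}$. $M^2$ is marginally trapped if it is spacelike and $H$ is lightlike at each point ($H\neq 0$, $\langle H,H\rangle=0$). Flat points: for a local parametrization $z(u,v)$ let $E=\langle z_u,z_u\rangle$, $F=\langle z_u,z_v\rangle$, $G=\langle z_v,z_v\rangle$, $W=\sqrt{EG-F^2}$; choose normal fields $e_3,e_4$ with $\langle e_3,e_3\rangle=1$, $\langle e_4,e_4\rangle=-1$, $\langle e_3,e_4\rangle=0$ and $\{z_u,z_v,e_3,e_4\}$ positively oriented; put $c_{ij}^k=\langle z_{ij},e_k\rangle$ and $L=\frac2W(c_{11}^3c_{12}^4-c_{12}^3c_{11}^4)$, $M=\frac1W(c_{11}^3c_{22}^4-c_{22}^3c_{11}^4)$, $N=\frac2W(c_{12}^3c_{22}^4-c_{22}^3c_{12}^4)$. A point is flat if $L=M=N=0$ there. Geometric frame: orthonormal tangent fields $x,y$ with $\sigma(x,x)$, $\sigma(y,y)$ collinear with $H$, $n_1=H$, $n_2$ the lightlike normal field with $\langle n_1,n_2\rangle=-1$;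 then $\sigma(x,x)=(1+\nu)n_1$, $\sigma(x,y)=\lambda n_1+\mu n_2$, $\sigma(y,y)=(1-\nu)n_1$. The geometric functions are $\nu,\lambda,\mu$ together with $\gamma_1=-y(\ln\sqrt E)$, $\gamma_2=-x(\ln\sqrt G)$, $\beta_1=-\langle\nabla'_xn_1,n_2\rangle$, $\beta_2=-\langle\nabla'_yn_1,n_2\rangle$, where $x(f)=f_u/\sqrt E$, $y(f)=f_v/\sqrt G$. *)

theory Defs
  imports "HOL-Analysis.Analysis"
begin

definition mink :: "real^4 \<Rightarrow> real^4 \<Rightarrow> real" where
  "mink a b = a$1 * b$1 + a$2 * b$2 + a$3 * b$3 - a$4 * b$4"

definition pu :: "(real \<times> real \<Rightarrow> 'a::real_normed_vector) \<Rightarrow> real \<times> real \<Rightarrow> 'a" where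
  "pu f p = vector_derivative (\<lambda>t. f (t, snd p)) (at (fst p))"

definition pv :: "(real \<times> real \<Rightarrow> 'a::real_normed_vector) \<Rightarrow> real \<times> real \<Rightarrow> 'a" where
  "pv f p = vector_derivative (\<lambda>t. f (fst p, t)) (at (snd p))"

fun Ck :: "nat \<Rightarrow> (real \<times> real) set \<Rightarrow> (real \<times> real \<Rightarrow> 'a::real_normed_vector) \<Rightarrow> bool" where
  "Ck 0 D f = continuous_on D f"
| "Ck (Suc k) D f = (continuous_on D f \<and> (\<forall>p\<in>D. f differentiable (at p))
                      \<and> Ck k D (pu f) \<and> Ck k D (pv f))"

definition smooth2_on :: "(real \<times> real) set \<Rightarrow> (real \<times> real \<Rightarrow> 'a::real_normed_vector) \<Rightarrow> bool" where
  "smooth2_on D f = (\<forall>k. Ck k D f)"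

definition domain2 :: "(real \<times> real) set \<Rightarrow> bool" where
  "domain2 D = (open D \<and> connected D \<and> D \<noteq> {})"

type_synonym surf = "real \<times> real \<Rightarrow> real^4"

definition fE :: "surf \<Rightarrow> real \<times> real \<Rightarrow> real" where
  "fE z p = mink (pu z p) (pu z p)"
definition fF :: "surf \<Rightarrow> real \<times> real \<Rightarrow> real" where
  "fF z p = mink (pu z p) (pv z p)"
definition fG :: "surf \<Rightarrow> real \<times> real \<Rightarrow> real" where
  "fG z p = mink (pv z p) (pv z p)"

definition tc1 :: "surf \<Rightarrow> real \<times> real \<Rightarrow> real^4 \<Rightarrow> real" where
  "tc1 z p w = (fG z p * mink w (pu z p) - fF z p * mink w (pv z p))
               / (fE z p * fG z p - (fF z p)\<^sup>2)"
definition tc2 :: "surf \<Rightarrow> real \<times> real \<Rightarrow> real^4 \<Rightarrow> real" where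
  "tc2 z p w = (fE z p * mink w (pv z p) - fF z p * mink w (pu z p))
               / (fE z p * fG z p - (fF z p)\<^sup>2)"

definition tang_part :: "surf \<Rightarrow> real \<times> real \<Rightarrow> real^4 \<Rightarrow> real^4" where
  "tang_part z p w = tc1 z p w *\<^sub>R pu z p + tc2 z p w *\<^sub>R pv z p"

definition nor_part :: "surf \<Rightarrow> real \<times> real \<Rightarrow> real^4 \<Rightarrow> real^4" where
  "nor_part z p w = w - tang_part z p w"

definition is_tangent :: "surf \<Rightarrow> real \<times> real \<Rightarrow> real^4 \<Rightarrow> bool" where
  "is_tangent z p w = (\<exists>a b. w = a *\<^sub>R pu z p + b *\<^sub>R pv z p)"

definition is_normal :: "surf \<Rightarrow> real \<times> real \<Rightarrow> real^4 \<Rightarrow> bool" where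
  "is_normal z p w = (mink w (pu z p) = 0 \<and> mink w (pv z p) = 0)"

definition s11 :: "surf \<Rightarrow> real \<times> real \<Rightarrow> real^4" where
  "s11 z p = nor_part z p (pu (pu z) p)"
definition s12 :: "surf \<Rightarrow> real \<times> real \<Rightarrow> real^4" where
  "s12 z p = nor_part z p (pv (pu z) p)"
definition s22 :: "surf \<Rightarrow> real \<times> real \<Rightarrow> real^4" where
  "s22 z p = nor_part z p (pv (pv z) p)"

definition sff :: "surf \<Rightarrow> real \<times> real \<Rightarrow> real^4 \<Rightarrow> real^4 \<Rightarrow> real^4" where
  "sff z p X Y = (tc1 z p X * tc1 z p Y) *\<^sub>R s11 z p
     + (tc1 z p X * tc2 z p Y + tc2 z p X * tc1 z p Y) *\<^sub>R s12 z p
     + (tc2 z p X * tc2 z p Y) *\<^sub>R s22 z p"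

text \<open>Mean curvature vector H = (1/2) trace sigma, written in coordinates.\<close>
definition meanH :: "surf \<Rightarrow> real \<times> real \<Rightarrow> real^4" where
  "meanH z p = (1 / (2 * (fE z p * fG z p - (fF z p)\<^sup>2))) *\<^sub>R
      (fG z p *\<^sub>R s11 z p - (2 * fF z p) *\<^sub>R s12 z p + fE z p *\<^sub>R s22 z p)"

definition spacelike_on :: "(real \<times> real) set \<Rightarrow> surf \<Rightarrow> bool" where
  "spacelike_on D z = (\<forall>p\<in>D. fE z p > 0 \<and> fE z p * fG z p - (fF z p)\<^sup>2 > 0)"

definition marginally_trapped_on :: "(real \<times> real) set \<Rightarrow> surf \<Rightarrow> bool" where
  "marginally_trapped_on D z = (smooth2_on D z \<and> spacelike_on D z \<and>
     (\<forall>p\<in>D. meanH z p \<noteq> 0 \<and> mink (meanH z p) (meanH z p) = 0))"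

definition flat_point :: "surf \<Rightarrow> real \<times> real \<Rightarrow> bool" where
  "flat_point z p = (\<exists>e3 e4.
     is_normal z p e3 \<and> is_normal z p e4 \<and>
     mink e3 e3 = 1 \<and> mink e4 e4 = -1 \<and> mink e3 e4 = 0 \<and>
     det (vector [pu z p, pv z p, e3, e4] :: real^4^4) > 0 \<and>
     (let W = sqrt (fE z p * fG z p - (fF z p)\<^sup>2);
          c113 = mink (pu (pu z) p) e3; c114 = mink (pu (pu z) p) e4;
          c123 = mink (pv (pu z) p) e3; c124 = mink (pv (pu z) p) e4;
          c223 = mink (pv (pv z) p) e3; c224 = mink (pv (pv z) p) e4;
          L = 2 / W * (c113 * c124 - c123 * c114);
          M = 1 / W * (c113 * c224 - c223 * c114);
          N = 2 / W * (c123 * c224 - c223 * c124)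
      in L = 0 \<and> M = 0 \<and> N = 0))"

definition geometric_frame_on :: "(real \<times> real) set \<Rightarrow> surf \<Rightarrow> surf \<Rightarrow> surf \<Rightarrow> surf \<Rightarrow> surf \<Rightarrow> bool" where
  "geometric_frame_on D z x y n1 n2 = (\<forall>p\<in>D.
     is_tangent z p (x p) \<and> is_tangent z p (y p) \<and>
     mink (x p) (x p) = 1 \<and> mink (y p) (y p) = 1 \<and> mink (x p) (y p) = 0 \<and>
     (\<exists>c. sff z p (x p) (x p) = c *\<^sub>R meanH z p) \<and>
     (\<exists>c. sff z p (y p) (y p) = c *\<^sub>R meanH z p) \<and>
     n1 p = meanH z p \<and>
     is_normal z p (n2 p) \<and> mink (n2 p) (n2 p) = 0 \<and> mink (n1 p) (n2 p) = -1)"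

end

theory Submission
  imports Defs
begin

text \<open>The derivative formulas form a linear total system \<open>F\<^sub>u = A F\<close>, \<open>F\<^sub>v = B F\<close> for the matrix
  \<open>F\<close> of frame vectors, and the hypotheses, together with the definitions of \<open>\<surd>E\<close> and
  \<open>\<surd>G\<close>, are exactly its compatibility condition \<open>A\<^sub>v + A B = B\<^sub>u + B A\<close>. Hence it has a local
  solution with the prescribed initial frame. The coefficients are skew with respect to the Gram
  matrix of the initial frame, so this Gram matrix is preserved. The first two equations
  make \<open>\<surd>E x du + \<surd>G y dv\<close> closed; its primitive is the surface, whose mean curvature
  vector is \<open>n\<^sub>1\<close>. Flat points are excluded by \<open>\<mu> \<noteq> 0\<close>, because \<open>\<sigma>(x,x)\<close> and
  \<open>\<sigma>(y,y)\<close> cannot both vanish. Uniqueness is uniqueness for linear systems.\<close>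

section \<open>Calculus of iterated partial derivatives\<close>

text \<open>The definitions of \<open>sE\<close> and \<open>sG\<close> act as differential
  equations: solved for \<open>pu mu\<close> and \<open>pv mu\<close> they are the
  \<open>n2\<close>-components of the Codazzi equations, and positivity of the quotients forces
  \<open>mu\<close> to be nonzero. The first two equations tie \<open>g1\<close>, \<open>g2\<close>
  to the metric; the others are the Gauss equation, the two \<open>n1\<close>-components of Codazzi,
  and the Ricci equation. The obstacle is the frame. Integration along an L-shaped path yields a
  function whose \<open>v\<close>-derivative is right but whose \<open>u\<close>-derivative is
  unknown off the base line, so that it cannot simply be differentiated twice. The defect is
  therefore estimated through integrals, and smoothness is bootstrapped from the system only after
  both partial derivatives are known. Smallness of the square serves both the contraction and the
  defect estimate. The surface lives on half of the square of the frame, so that the closed half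
  square lies where the frame is smooth.\<close>

lemma has_vector_derivative_pu:
  assumes "f differentiable (at p)"
  shows "((\<lambda>t. f (t, snd p)) has_vector_derivative pu f p) (at (fst p))"
proof -
  have "(f \<circ> (\<lambda>t. (t, snd p))) differentiable (at (fst p))"
    by (rule differentiable_chain_at) (use assms in \<open>auto intro!: derivative_intros\<close>)
  then show ?thesis
    unfolding pu_def by (simp add: vector_derivative_works o_def)
qed

lemma has_vector_derivative_pv:
  assumes "f differentiable (at p)"
  shows "((\<lambda>t. f (fst p, t)) has_vector_derivative pv f p) (at (snd p))"
proof -
  have "(f \<circ> (\<lambda>t. (fst p, t))) differentiable (at (snd p))"
    by (rule differentiable_chain_at) (use assms in \<open>auto intro!: derivative_intros\<close>)
  then show ?thesis
    unfolding pv_def by (simp add: vector_derivative_works o_def)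
qed

lemma pu_eqI: "((\<lambda>t. f (t, snd p)) has_vector_derivative d) (at (fst p)) \<Longrightarrow> pu f p = d"
  unfolding pu_def by (rule vector_derivative_at)

lemma pv_eqI: "((\<lambda>t. f (fst p, t)) has_vector_derivative d) (at (snd p)) \<Longrightarrow> pv f p = d"
  unfolding pv_def by (rule vector_derivative_at)

lemma eventually_section_u:
  assumes "open D" "p \<in> D"
  shows "\<forall>\<^sub>F t in nhds (fst p). (t, snd p) \<in> D"
proof -
  have "open ((\<lambda>t. (t, snd p)) -` D)"
    by (rule open_vimage) (use assms in \<open>auto intro!: continuous_intros\<close>)
  then show ?thesis
    using assms(2) by (auto simp: eventually_nhds intro!: exI[of _ "(\<lambda>t. (t, snd p)) -` D"])
qed

lemma eventually_section_v:
  assumes "open D" "p \<in> D"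
  shows "\<forall>\<^sub>F t in nhds (snd p). (fst p, t) \<in> D"
proof -
  have "open ((\<lambda>t. (fst p, t)) -` D)"
    by (rule open_vimage) (use assms in \<open>auto intro!: continuous_intros\<close>)
  then show ?thesis
    using assms(2) by (auto simp: eventually_nhds intro!: exI[of _ "(\<lambda>t. (fst p, t)) -` D"])
qed

lemma pu_cong:
  assumes "open D" "\<And>q. q \<in> D \<Longrightarrow> f q = g q" "p \<in> D"
  shows "pu f p = pu g p"
  unfolding pu_def
  by (rule vector_derivative_cong_eq)
     (use assms in \<open>auto intro: eventually_mono[OF eventually_section_u[OF assms(1,3)]]\<close>)

lemma pv_cong:
  assumes "open D" "\<And>q. q \<in> D \<Longrightarrow> f q = g q" "p \<in> D"
  shows "pv f p = pv g p"
  unfolding pv_def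
  by (rule vector_derivative_cong_eq)
     (use assms in \<open>auto intro: eventually_mono[OF eventually_section_v[OF assms(1,3)]]\<close>)

text \<open>Rules such as the product rule identify \<open>pu\<close> of a compound function only at
  points of \<open>D\<close>, so the induction on the order needs \<open>Ck\<close> to depend on the
  values on \<open>D\<close> alone. Openness makes this true, since derivatives are local.\<close>

lemma Ck_cong:
  assumes "open D" "\<And>q. q \<in> D \<Longrightarrow> f q = g q" "Ck k D f"
  shows "Ck k D g"
  using assms(2,3)
proof (induction k arbitrary: f g)
  case 0
  then show ?case
    by (simp cong: continuous_on_cong)
next
  case (Suc k)
  have "g differentiable (at p)" if "p \<in> D" for p
  proof -
    have "f differentiable (at p)"
      using Suc.prems that by simp
    then show ?thesis
      unfolding differentiable_def
      using Suc.prems(1) that assms(1) has_derivative_transform_within_open by blast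
  qed
  moreover have "continuous_on D g"
    using Suc.prems by (simp cong: continuous_on_cong)
  moreover have "Ck k D (pu g)"
    by (rule Suc.IH[of "pu f"]) (use Suc.prems in \<open>auto intro: pu_cong[OF assms(1)]\<close>)
  moreover have "Ck k D (pv g)"
    by (rule Suc.IH[of "pv f"]) (use Suc.prems in \<open>auto intro: pv_cong[OF assms(1)]\<close>)
  ultimately show ?case
    by simp
qed

lemma Ck_SucD:
  assumes "Ck (Suc k) D f"
  shows "continuous_on D f" "p \<in> D \<Longrightarrow> f differentiable (at p)" "Ck k D (pu f)" "Ck k D (pv f)"
  using assms by simp_all

lemma Ck_SucI:
  assumes "continuous_on D f" "\<And>p. p \<in> D \<Longrightarrow> f differentiable (at p)" "Ck k D (pu f)" "Ck k D (pv f)"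
  shows "Ck (Suc k) D f"
  using assms by simp

lemma Ck_subset: "Ck k D f \<Longrightarrow> S \<subseteq> D \<Longrightarrow> Ck k S f"
proof (induction k arbitrary: f)
  case (Suc k)
  show ?case
    by (rule Ck_SucI) (use Suc.prems Ck_SucD[OF Suc.prems(1)] in
      \<open>blast intro: Suc.IH continuous_on_subset\<close>)+
qed (simp add: continuous_on_subset)

text \<open>In a product rule one factor stays undifferentiated; its order has to drop to that of
  the derivative before the induction hypothesis applies.\<close>

lemma Ck_Suc_imp: "Ck (Suc k) D f \<Longrightarrow> Ck k D f"
proof (induction k arbitrary: f)
  case (Suc k)
  show ?case
    by (rule Ck_SucI) (use Suc.prems Ck_SucD[OF Suc.prems] in \<open>blast intro: Suc.IH\<close>)+
qed simp

lemma Ck_continuous: "Ck k D f \<Longrightarrow> continuous_on D f"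
  by (cases k) simp_all

lemma pu_const [simp]: "pu (\<lambda>_. c) p = 0" and pv_const [simp]: "pv (\<lambda>_. c) p = 0"
  by (simp_all add: pu_def pv_def)

lemma Ck_const: "Ck k D (\<lambda>_. c)"
proof (induction k arbitrary: c)
  case (Suc k)
  have "pu (\<lambda>_. c) = (\<lambda>_. 0)" "pv (\<lambda>_. c) = (\<lambda>_. 0)"
    by auto
  then show ?case
    using Suc by simp
qed simp

lemma pu_add:
  "f differentiable (at p) \<Longrightarrow> g differentiable (at p) \<Longrightarrow> pu (\<lambda>q. f q + g q) p = pu f p + pu g p"
  by (rule pu_eqI, rule has_vector_derivative_add; rule has_vector_derivative_pu)

lemma pv_add:
  "f differentiable (at p) \<Longrightarrow> g differentiable (at p) \<Longrightarrow> pv (\<lambda>q. f q + g q) p = pv f p + pv g p"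
  by (rule pv_eqI, rule has_vector_derivative_add; rule has_vector_derivative_pv)

lemma Ck_add:
  assumes "open D" "Ck k D f" "Ck k D g"
  shows "Ck k D (\<lambda>q. f q + g q)"
  using assms(2,3)
proof (induction k arbitrary: f g)
  case (Suc k)
  note f = Ck_SucD[OF Suc.prems(1)] and g = Ck_SucD[OF Suc.prems(2)]
  show ?case
  proof (rule Ck_SucI)
    show "Ck k D (pu (\<lambda>q. f q + g q))"
      by (rule Ck_cong[OF assms(1) _ Suc.IH[OF f(3) g(3)]]) (simp add: pu_add f(2) g(2))
    show "Ck k D (pv (\<lambda>q. f q + g q))"
      by (rule Ck_cong[OF assms(1) _ Suc.IH[OF f(4) g(4)]]) (simp add: pv_add f(2) g(2))
  qed (auto intro!: continuous_on_add differentiable_add f(1,2) g(1,2))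
qed (simp add: continuous_on_add)

lemma pu_linear:
  "bounded_linear h \<Longrightarrow> f differentiable (at p) \<Longrightarrow> pu (\<lambda>q. h (f q)) p = h (pu f p)"
  by (rule pu_eqI, rule bounded_linear.has_vector_derivative, assumption, rule has_vector_derivative_pu)

lemma pv_linear:
  "bounded_linear h \<Longrightarrow> f differentiable (at p) \<Longrightarrow> pv (\<lambda>q. h (f q)) p = h (pv f p)"
  by (rule pv_eqI, rule bounded_linear.has_vector_derivative, assumption, rule has_vector_derivative_pv)

lemma differentiable_linear_compose:
  assumes "bounded_linear h" "f differentiable F"
  shows "(\<lambda>x. h (f x)) differentiable F"
proof -
  obtain f' where "(f has_derivative f') F"
    using assms(2) unfolding differentiable_def by blast
  from bounded_linear.has_derivative[OF assms(1) this] show ?thesis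
    unfolding differentiable_def by blast
qed

lemma Ck_linear:
  assumes "bounded_linear h" "open D" "Ck k D f"
  shows "Ck k D (\<lambda>q. h (f q))"
  using assms(3)
proof (induction k arbitrary: f)
  case (Suc k)
  note f = Ck_SucD[OF Suc.prems(1)]
  show ?case
  proof (rule Ck_SucI)
    show "Ck k D (pu (\<lambda>q. h (f q)))"
      by (rule Ck_cong[OF assms(2) _ Suc.IH[OF f(3)]]) (simp add: pu_linear[OF assms(1)] f(2))
    show "Ck k D (pv (\<lambda>q. h (f q)))"
      by (rule Ck_cong[OF assms(2) _ Suc.IH[OF f(4)]]) (simp add: pv_linear[OF assms(1)] f(2))
  qed (rule bounded_linear.continuous_on[OF assms(1) f(1)]
        differentiable_linear_compose[OF assms(1) f(2)], assumption?)+
qed (simp add: bounded_linear.continuous_on[OF assms(1)])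

lemma pu_bilinear:
  assumes "bounded_bilinear h" "f differentiable (at p)" "g differentiable (at p)"
  shows "pu (\<lambda>q. h (f q) (g q)) p = h (f p) (pu g p) + h (pu f p) (g p)"
  using bounded_bilinear.has_vector_derivative[OF assms(1) has_vector_derivative_pu[OF assms(2)]
      has_vector_derivative_pu[OF assms(3)]]
  by (intro pu_eqI) simp

lemma pv_bilinear:
  assumes "bounded_bilinear h" "f differentiable (at p)" "g differentiable (at p)"
  shows "pv (\<lambda>q. h (f q) (g q)) p = h (f p) (pv g p) + h (pv f p) (g p)"
  using bounded_bilinear.has_vector_derivative[OF assms(1) has_vector_derivative_pv[OF assms(2)]
      has_vector_derivative_pv[OF assms(3)]]
  by (intro pv_eqI) simp

lemma differentiable_bilinear_compose:
  assumes "bounded_bilinear h" "f differentiable (at x)" "g differentiable (at x)"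
  shows "(\<lambda>x. h (f x) (g x)) differentiable (at x)"
proof -
  obtain f' g' where "(f has_derivative f') (at x)" "(g has_derivative g') (at x)"
    using assms(2,3) unfolding differentiable_def by blast
  from bounded_bilinear.FDERIV[OF assms(1) this] show ?thesis
    unfolding differentiable_def by blast
qed

text \<open>One Leibniz rule for real products, scalar multiples and matrix products: the derivative
  is a sum of two terms of the same bilinear form, with one factor differentiated and the other
  lowered in order.\<close>

lemma Ck_bilinear:
  assumes "bounded_bilinear h" "open D" "Ck k D f" "Ck k D g"
  shows "Ck k D (\<lambda>q. h (f q) (g q))"
  using assms(3,4)
proof (induction k arbitrary: f g)
  case (Suc k)
  note f = Ck_SucD[OF Suc.prems(1)] and g = Ck_SucD[OF Suc.prems(2)]
  note fg = Ck_Suc_imp[OF Suc.prems(1)] Ck_Suc_imp[OF Suc.prems(2)]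
  show ?case
  proof (rule Ck_SucI)
    show "Ck k D (pu (\<lambda>q. h (f q) (g q)))"
      by (rule Ck_cong[OF assms(2) _ Ck_add[OF assms(2) Suc.IH[OF fg(1) g(3)] Suc.IH[OF f(3) fg(2)]]])
         (simp add: pu_bilinear[OF assms(1)] f(2) g(2))
    show "Ck k D (pv (\<lambda>q. h (f q) (g q)))"
      by (rule Ck_cong[OF assms(2) _ Ck_add[OF assms(2) Suc.IH[OF fg(1) g(4)] Suc.IH[OF f(4) fg(2)]]])
         (simp add: pv_bilinear[OF assms(1)] f(2) g(2))
  qed (rule bounded_bilinear.continuous_on[OF assms(1) f(1) g(1)]
        differentiable_bilinear_compose[OF assms(1) f(2) g(2)], assumption?)+
qed (simp add: bounded_bilinear.continuous_on[OF assms(1)])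

lemma Ck_sum:
  assumes "open D" "\<And>i. i \<in> I \<Longrightarrow> Ck k D (f i)"
  shows "Ck k D (\<lambda>q. \<Sum>i\<in>I. f i q)"
proof (cases "finite I")
  case True
  then show ?thesis
    using assms(2) by (induction I) (simp_all add: Ck_const Ck_add[OF assms(1)])
qed (simp add: Ck_const)

lemma pu_inverse:
  fixes f :: "real \<times> real \<Rightarrow> real"
  assumes "f differentiable (at p)" "f p \<noteq> 0"
  shows "pu (\<lambda>q. inverse (f q)) p = - (pu f p * (inverse (f p) * inverse (f p)))"
  using has_vector_derivative_pu[OF assms(1)] assms(2)
  by (intro pu_eqI)
     (auto simp: has_real_derivative_iff_has_vector_derivative[symmetric] power2_eq_square
       divide_simps intro!: derivative_eq_intros)

lemma pv_inverse:
  fixes f :: "real \<times> real \<Rightarrow> real"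
  assumes "f differentiable (at p)" "f p \<noteq> 0"
  shows "pv (\<lambda>q. inverse (f q)) p = - (pv f p * (inverse (f p) * inverse (f p)))"
  using has_vector_derivative_pv[OF assms(1)] assms(2)
  by (intro pv_eqI)
     (auto simp: has_real_derivative_iff_has_vector_derivative[symmetric] power2_eq_square
       divide_simps intro!: derivative_eq_intros)

text \<open>The derivative of the reciprocal is a product of \<open>pu f\<close> with two copies of
  the reciprocal itself, which is of order \<open>k\<close> by induction.\<close>

lemma Ck_inverse:
  fixes f :: "real \<times> real \<Rightarrow> real"
  assumes "open D" "Ck k D f" "\<And>q. q \<in> D \<Longrightarrow> f q \<noteq> 0"
  shows "Ck k D (\<lambda>q. inverse (f q))"
  using assms(2)
proof (induction k)
  case (Suc k)
  note f = Ck_SucD[OF Suc.prems(1)]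
  note i = Suc.IH[OF Ck_Suc_imp[OF Suc.prems]]
  note b = Ck_bilinear[OF bounded_bilinear_mult assms(1)]
  note l = Ck_linear[OF bounded_linear_minus[OF bounded_linear_ident] assms(1)]
  show ?case
  proof (rule Ck_SucI)
    show "Ck k D (pu (\<lambda>q. inverse (f q)))"
      by (rule Ck_cong[OF assms(1) _ l[OF b[OF f(3) b[OF i i]]]]) (simp add: pu_inverse f(2) assms(3))
    show "Ck k D (pv (\<lambda>q. inverse (f q)))"
      by (rule Ck_cong[OF assms(1) _ l[OF b[OF f(4) b[OF i i]]]]) (simp add: pv_inverse f(2) assms(3))
  qed (use assms(3) f(1,2) in \<open>auto intro!: continuous_on_inverse differentiable_inverse\<close>)
qed (use assms(3) in \<open>auto intro!: continuous_on_inverse\<close>)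

section \<open>Closure properties of smooth functions\<close>

lemma smooth2_on_subset: "smooth2_on D f \<Longrightarrow> S \<subseteq> D \<Longrightarrow> smooth2_on S f"
  by (simp add: smooth2_on_def Ck_subset[of _ D])

lemma smooth2_on_const: "smooth2_on D (\<lambda>_. c)"
  by (simp add: smooth2_on_def Ck_const)

lemma smooth2_on_add:
  "open D \<Longrightarrow> smooth2_on D f \<Longrightarrow> smooth2_on D g \<Longrightarrow> smooth2_on D (\<lambda>q. f q + g q)"
  by (simp add: smooth2_on_def Ck_add)

lemma smooth2_on_linear:
  assumes "bounded_linear h" "open D" "smooth2_on D f"
  shows "smooth2_on D (\<lambda>q. h (f q))"
  using assms(3) Ck_linear[OF assms(1,2)] by (simp add: smooth2_on_def)

lemma smooth2_on_bilinear:
  assumes "bounded_bilinear h" "open D" "smooth2_on D f" "smooth2_on D g"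
  shows "smooth2_on D (\<lambda>q. h (f q) (g q))"
  using assms(3,4) Ck_bilinear[OF assms(1,2)] by (simp add: smooth2_on_def)

lemmas smooth2_on_mult = smooth2_on_bilinear[OF bounded_bilinear_mult]
lemmas smooth2_on_scaleR = smooth2_on_bilinear[OF bounded_bilinear_scaleR]
lemmas smooth2_on_minus = smooth2_on_linear[OF bounded_linear_minus[OF bounded_linear_ident]]
lemmas smooth2_on_vec_nth = smooth2_on_linear[OF bounded_linear_vec_nth]

lemma smooth2_on_diff:
  assumes "open D" "smooth2_on D f" "smooth2_on D g"
  shows "smooth2_on D (\<lambda>q. f q - g q)"
  using smooth2_on_add[OF assms(1,2) smooth2_on_minus[OF assms(1,3)]] by simp

lemma smooth2_on_sum:
  assumes "open D" "\<And>i. i \<in> I \<Longrightarrow> smooth2_on D (f i)"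
  shows "smooth2_on D (\<lambda>q. \<Sum>i\<in>I. f i q)"
  using assms(2) Ck_sum[OF assms(1), of I _ f] by (simp add: smooth2_on_def)

lemma smooth2_on_divide:
  fixes f g :: "real \<times> real \<Rightarrow> real"
  assumes "open D" "smooth2_on D f" "smooth2_on D g" "\<And>q. q \<in> D \<Longrightarrow> g q \<noteq> 0"
  shows "smooth2_on D (\<lambda>q. f q / g q)"
proof -
  have "smooth2_on D (\<lambda>q. inverse (g q))"
    using assms(3) Ck_inverse[OF assms(1) _ assms(4)] by (simp add: smooth2_on_def)
  from smooth2_on_mult[OF assms(1,2) this] show ?thesis
    by (simp add: divide_inverse)
qed

lemma bounded_linear_axis: "bounded_linear (axis i :: 'a::real_normed_vector \<Rightarrow> 'a^'n)"
proof (rule bounded_linear_intro[where K=1])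
  fix x :: 'a
  have "norm (axis i x :: 'a^'n) \<le> (\<Sum>j\<in>UNIV. norm ((axis i x :: 'a^'n) $ j))"
    unfolding norm_vec_def by (rule L2_set_le_sum) simp
  also have "\<dots> = (\<Sum>j\<in>UNIV. if j = i then norm x else 0)"
    by (rule sum.cong) (auto simp: axis_def)
  finally show "norm (axis i x :: 'a^'n) \<le> norm x * 1"
    by simp
qed (auto simp: vec_eq_iff axis_def)

lemma vec_lambda_eq_sum_axis: "(\<chi> i. f i) = (\<Sum>i\<in>UNIV. axis i (f i :: 'a::comm_monoid_add))"
  by (simp add: vec_eq_iff axis_def sum_component if_distrib[of "\<lambda>x. x = _"] cong: if_cong)

text \<open>A vector is the finite sum of its entries placed on the axes, and placing an entry is
  linear; sums and linear maps preserve smoothness.\<close>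

lemma smooth2_on_vec_lambda:
  fixes f :: "real \<times> real \<Rightarrow> 'n::finite \<Rightarrow> 'a::real_normed_vector"
  assumes "open D" "\<And>i. smooth2_on D (\<lambda>q. f q i)"
  shows "smooth2_on D (\<lambda>q. \<chi> i. f q i)"
  unfolding vec_lambda_eq_sum_axis
  by (intro smooth2_on_sum smooth2_on_linear[OF bounded_linear_axis] assms)

lemma smooth2_on_pu: "smooth2_on D f \<Longrightarrow> smooth2_on D (pu f)"
  and smooth2_on_pv: "smooth2_on D f \<Longrightarrow> smooth2_on D (pv f)"
  using Ck_SucD(3,4)[of _ D f] by (auto simp only: smooth2_on_def)

lemma smooth2_on_differentiable:
  assumes "smooth2_on D f" "p \<in> D"
  shows "f differentiable (at p)"
  using assms Ck_SucD(2)[of 0 D f p] by (simp only: smooth2_on_def)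

lemma smooth2_on_continuous:
  assumes "smooth2_on D f"
  shows "continuous_on D f"
  using assms Ck_continuous[of 0 D f] by (simp only: smooth2_on_def)

text \<open>On a product neighbourhood with a convex second factor, continuity of \<open>fv\<close>
  controls the increments in \<open>v\<close>, while the increment in \<open>u\<close> is taken
  along the line through \<open>p\<close>.\<close>

lemma differentiable_of_continuous_partials:
  fixes f :: "real \<times> real \<Rightarrow> 'a::real_normed_vector"
  assumes "open D" "p \<in> D"
    and u: "\<And>q. q \<in> D \<Longrightarrow> ((\<lambda>t. f (t, snd q)) has_vector_derivative fu q) (at (fst q))"
    and v: "\<And>q. q \<in> D \<Longrightarrow> ((\<lambda>t. f (fst q, t)) has_vector_derivative fv q) (at (snd q))"
    and c: "continuous_on D fv"
  shows "f differentiable (at p)"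
proof -
  obtain X Y where XY: "open X" "open Y" "p \<in> X \<times> Y" "X \<times> Y \<subseteq> D"
    by (rule open_prod_elim[OF assms(1,2)])
  have "snd p \<in> Y"
    using XY(3) by auto
  then obtain e where e: "e > 0" "ball (snd p) e \<subseteq> Y"
    using XY(2) by (auto simp: open_contains_ball)
  let ?Y = "ball (snd p) e"
  have D: "X \<times> ?Y \<subseteq> D"
    using XY e by blast
  have "((\<lambda>(x, y). f (x, y)) has_derivative (\<lambda>(tx, ty). tx *\<^sub>R fu p + blinfun_apply (blinfun_scaleR_left (fv (fst p, snd p))) ty))
      (at (fst p, snd p) within X \<times> ?Y)"
  proof (rule has_derivative_partialsI)
    show "((\<lambda>x. f (x, snd p)) has_derivative (\<lambda>tx. tx *\<^sub>R fu p)) (at (fst p) within X)"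
      by (rule has_derivative_at_withinI) (use u[OF assms(2)] in \<open>simp add: has_vector_derivative_def\<close>)
    show "((\<lambda>y. f (x, y)) has_derivative blinfun_apply (blinfun_scaleR_left (fv (x, y)))) (at y within ?Y)"
      if "x \<in> X" "y \<in> ?Y" for x y
      proof (rule has_derivative_at_withinI)
      have "(x, y) \<in> D"
        using that D by blast
      from v[OF this] show "((\<lambda>y. f (x, y)) has_derivative blinfun_apply (blinfun_scaleR_left (fv (x, y)))) (at y)"
        by (simp add: has_vector_derivative_def blinfun_scaleR_left.rep_eq)
    qed
    have "continuous_on (X \<times> ?Y) (\<lambda>(x, y). blinfun_scaleR_left (fv (x, y)))"
      unfolding case_prod_unfold prod.collapse
      by (rule bounded_linear.continuous_on[OF bounded_linear_blinfun_scaleR_left],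
          rule continuous_on_subset[OF c D])
    then show "continuous (at (fst p, snd p) within X \<times> ?Y) (\<lambda>(x, y). blinfun_scaleR_left (fv (x, y)))"
      unfolding continuous_on_eq_continuous_within by (rule bspec) (use XY e in auto)
  qed (use e in auto)
  moreover have "open (X \<times> ?Y)" "(fst p, snd p) \<in> X \<times> ?Y"
    using XY e by (auto intro: open_Times)
  ultimately show ?thesis
    unfolding differentiable_def by (simp only: at_within_open case_prod_beta' prod.collapse) (rule exI)
qed

section \<open>Oriented primitives\<close>

text \<open>The substitution \<open>s = b + t (u - b)\<close> turns the oriented integral from \<open>b\<close> to \<open>u\<close> into an
  integral over a fixed interval, whatever the order of \<open>b\<close> and \<open>u\<close>.\<close>

definition prim :: "real \<Rightarrow> (real \<Rightarrow> 'a::banach) \<Rightarrow> real \<Rightarrow> 'a" where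
  "prim b g u = (u - b) *\<^sub>R integral {0..1} (\<lambda>t. g (b + t * (u - b)))"

lemma between_mem_interval:
  assumes "b \<in> {c..d}" "u \<in> {c..d}" "t \<in> {0..1::real}"
  shows "b + t * (u - b) \<in> {c..d}"
proof -
  have "(1 - t) *\<^sub>R b + t *\<^sub>R u \<in> {c..d}"
    using assms convexD_alt[of "{c..d}" b u t] by simp
  then show ?thesis
    by (simp add: algebra_simps)
qed

lemma continuous_on_between:
  fixes g :: "real \<Rightarrow> 'a::banach"
  assumes "continuous_on {c..d} g" "b \<in> {c..d}" "u \<in> {c..d}"
  shows "continuous_on {0..1} (\<lambda>t. g (b + t * (u - b)))"
  by (rule continuous_on_compose2[OF assms(1)])
     (use between_mem_interval[OF assms(2,3)] in \<open>auto intro!: continuous_intros\<close>)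

lemma prim_self [simp]: "prim b g b = 0"
  by (simp add: prim_def)

lemma prim_diff:
  assumes "continuous_on {c..d} f" "continuous_on {c..d} g" "b \<in> {c..d}" "u \<in> {c..d}"
  shows "prim b (\<lambda>s. f s - g s) u = prim b f u - prim b g u"
  unfolding prim_def
  by (subst integral_diff)
     (auto intro!: integrable_continuous_real continuous_on_between[OF _ assms(3,4)] assms(1,2)
       simp: scaleR_diff_right)

lemma norm_prim_le:
  assumes "continuous_on {c..d} g" "b \<in> {c..d}" "u \<in> {c..d}"
    and "\<And>s. s \<in> {c..d} \<Longrightarrow> norm (g s) \<le> M"
  shows "norm (prim b g u) \<le> \<bar>u - b\<bar> * M"
proof -
  have "norm (integral {0..1} (\<lambda>t. g (b + t * (u - b)))) \<le> M * (1 - 0)"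
    by (rule integral_bound)
       (use continuous_on_between[OF assms(1-3)] between_mem_interval[OF assms(2,3)] assms(4) in auto)
  then show ?thesis
    by (simp add: prim_def mult_left_mono)
qed

text \<open>By the chain rule along the segment from \<open>b\<close> to \<open>u\<close>, the
  integrand of \<open>prim\<close> is the derivative of \<open>h\<close> on the segment; the
  fundamental theorem on \<open>{0..1}\<close> then covers \<open>u < b\<close> as well.\<close>

lemma prim_eq_diff:
  assumes g: "continuous_on {c..d} g" and b: "b \<in> {c..d}" and u: "u \<in> {c..d}"
    and h: "\<And>s. s \<in> {c..d} \<Longrightarrow> (h has_vector_derivative g s) (at s within {c..d})"
  shows "prim b g u = h u - h b"
proof -
  let ?l = "\<lambda>t. b + t * (u - b)"
  have "((\<lambda>t. (u - b) *\<^sub>R g (?l t)) has_integral (h (?l 1) - h (?l 0))) {0..1}"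
  proof (rule fundamental_theorem_of_calculus)
    fix t :: real assume t: "t \<in> {0..1}"
    have "(?l has_vector_derivative (u - b)) (at t within {0..1})"
      by (auto intro!: derivative_eq_intros simp: has_real_derivative_iff_has_vector_derivative[symmetric])
    moreover have "(h has_vector_derivative g (?l t)) (at (?l t) within ?l ` {0..1})"
      by (rule has_vector_derivative_within_subset[OF h])
         (use between_mem_interval[OF b u] t in auto)
    ultimately show "((\<lambda>t. h (?l t)) has_vector_derivative (u - b) *\<^sub>R g (?l t)) (at t within {0..1})"
      using vector_diff_chain_within[of ?l "u - b" t "{0..1}" h] by (simp add: o_def)
  qed simp
  from integral_unique[OF this] show ?thesis
    by (simp add: prim_def)
qed

text \<open>\<open>prim b g\<close> differs by a constant from the indefinite integral starting at
  \<open>c\<close>, for which the derivative is known, one-sided at the end points.\<close>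

lemma has_vector_derivative_prim:
  assumes g: "continuous_on {c..d} g" and b: "b \<in> {c..d}" and u: "u \<in> {c..d}"
  shows "(prim b g has_vector_derivative g u) (at u within {c..d})"
proof -
  let ?G = "\<lambda>x. integral {c..x} g"
  have G: "(?G has_vector_derivative g s) (at s within {c..d})" if "s \<in> {c..d}" for s
    using integral_has_vector_derivative[OF g that] .
  have "((\<lambda>x. ?G x - ?G b) has_vector_derivative g u - 0) (at u within {c..d})"
    by (rule has_vector_derivative_diff[OF G[OF u] has_vector_derivative_const])
  then have "((\<lambda>x. ?G x - ?G b) has_vector_derivative g u) (at u within {c..d})"
    by simp
  then show ?thesis
    by (rule has_vector_derivative_transform[OF u, rotated]) (rule prim_eq_diff[OF g b _ G])
qed

text \<open>Since the interval of integration is fixed, a moving end point \<open>w x\<close> is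
  merely one more parameter of the integrand.\<close>

lemma continuous_on_prim:
  fixes g :: "'b::topological_space \<Rightarrow> real \<Rightarrow> 'a::banach"
  assumes g: "continuous_on (U \<times> {c..d}) (\<lambda>(x, s). g x s)"
    and w: "continuous_on U w" "\<And>x. x \<in> U \<Longrightarrow> w x \<in> {c..d}" and b: "b \<in> {c..d}"
  shows "continuous_on U (\<lambda>x. prim b (g x) (w x))"
proof -
  have m: "(x, b + t * (w x - b)) \<in> U \<times> {c..d}" if "x \<in> U" "t \<in> {0..1}" for x t
    using between_mem_interval[OF b w(2) that(2)] that by simp
  have "continuous_on (U \<times> cbox 0 1) (\<lambda>z. (\<lambda>(x, s). g x s) (fst z, b + snd z * (w (fst z) - b)))"
    by (rule continuous_on_compose2[OF g])
       (use m in \<open>auto intro!: continuous_intros continuous_on_compose2[OF w(1)] simp: cbox_interval\<close>)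
  then have "continuous_on (U \<times> cbox 0 1) (\<lambda>(x, t). g x (b + t * (w x - b)))"
    by (simp add: case_prod_unfold)
  from integral_continuous_on_param[OF this] show ?thesis
    unfolding prim_def by (intro continuous_intros w(1)) (simp add: cbox_interval)
qed

lemma prim_leibniz:
  fixes g :: "real \<Rightarrow> real \<Rightarrow> 'a::banach"
  assumes d: "\<And>x s. x \<in> V \<Longrightarrow> s \<in> {c..d} \<Longrightarrow> ((\<lambda>x. g x s) has_vector_derivative g' x s) (at x within V)"
    and c: "\<And>x. x \<in> V \<Longrightarrow> continuous_on {c..d} (g x)"
    and c': "continuous_on (V \<times> {c..d}) (\<lambda>(x, s). g' x s)"
    and V: "x \<in> V" "convex V" and bu: "b \<in> {c..d}" "u \<in> {c..d}"
  shows "((\<lambda>x. prim b (g x) u) has_vector_derivative prim b (g' x) u) (at x within V)"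
proof -
  let ?l = "\<lambda>t. b + t * (u - b)"
  have "continuous_on (V \<times> cbox 0 1) (\<lambda>z. (\<lambda>(x, s). g' x s) (fst z, ?l (snd z)))"
    by (rule continuous_on_compose2[OF c'])
       (use between_mem_interval[OF bu] in \<open>auto intro!: continuous_intros simp: cbox_interval\<close>)
  then have cg: "continuous_on (V \<times> cbox 0 1) (\<lambda>(x, t). g' x (?l t))"
    by (simp add: case_prod_unfold)
  have "((\<lambda>x. integral (cbox 0 1) (\<lambda>t. g x (?l t))) has_vector_derivative
      integral (cbox 0 1) (\<lambda>t. g' x (?l t))) (at x within V)"
  proof (rule leibniz_rule_vector_derivative[OF _ _ cg V])
    fix x t :: real assume xt: "x \<in> V" "t \<in> cbox 0 1"
    then have "?l t \<in> {c..d}"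
      by (intro between_mem_interval[OF bu]) (simp add: cbox_interval)
    from d[OF xt(1) this] show "((\<lambda>x. g x (?l t)) has_vector_derivative g' x (?l t)) (at x within V)" .
  next
    fix x assume "x \<in> V"
    from continuous_on_between[OF c[OF this] bu]
    show "(\<lambda>t. g x (?l t)) integrable_on cbox 0 1"
      unfolding cbox_interval by (rule integrable_continuous_real)
  qed
  then show ?thesis
    unfolding prim_def cbox_interval
    by (rule bounded_linear.has_vector_derivative[OF bounded_linear_scaleR_right])
qed

section \<open>Linear total systems\<close>

lemma bounded_bilinear_matrix_mul:
  "bounded_bilinear ((**) :: real^'n^'m \<Rightarrow> real^'k^'n \<Rightarrow> real^'k^'m)"
  unfolding bilinear_conv_bounded_bilinear[symmetric] bilinear_def
  by (auto intro!: linearI simp: vec_eq_iff matrix_matrix_mult_def sum.distrib[symmetric]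
      sum_distrib_left algebra_simps)

lemma continuous_on_matrix_mul:
  fixes f :: "'a::topological_space \<Rightarrow> real^'n^'m" and g :: "'a \<Rightarrow> real^'k^'n"
  shows "continuous_on S f \<Longrightarrow> continuous_on S g \<Longrightarrow> continuous_on S (\<lambda>x. f x ** g x)"
  by (rule bounded_bilinear.continuous_on[OF bounded_bilinear_matrix_mul])

text \<open>A uniform Lipschitz constant of the linear system; compactness is why closed squares and
  rectangles accompany the open ones below.\<close>

lemma matrix_mul_bounded:
  assumes "compact S" "continuous_on S (A :: 'a::topological_space \<Rightarrow> real^'n^'m)"
  obtains K where "K > 0" "\<And>p (w :: real^'k^'n). p \<in> S \<Longrightarrow> norm (A p ** w) \<le> K * norm w"
proof -
  obtain c where c: "c > 0" "\<And>a (w :: real^'k^'n). norm ((a :: real^'n^'m) ** w) \<le> norm a * norm w * c"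
    using bounded_bilinear.pos_bounded[OF bounded_bilinear_matrix_mul] by blast
  have "bounded (A ` S)"
    by (intro compact_imp_bounded compact_continuous_image assms)
  then obtain M where M: "M > 0" "\<And>p. p \<in> S \<Longrightarrow> norm (A p) \<le> M"
    unfolding bounded_pos by auto
  have "norm (A p ** w) \<le> M * c * norm w" if "p \<in> S" for p and w :: "real^'k^'n"
  proof -
    have "norm (A p) * norm w * c \<le> M * norm w * c"
      using M(2)[OF that] c(1) by (intro mult_right_mono) auto
    with c(2)[of "A p" w] show ?thesis
      by (simp add: mult_ac)
  qed
  with that[of "M * c"] M(1) c(1) show thesis
    by simp
qed

text \<open>The coefficients are integrated first along the horizontal line through the base point, then
  vertically. On a small square this is a contraction, without any compatibility of \<open>A\<close> and \<open>B\<close>.\<close>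

lemma path_integral_equation:
  fixes A B :: "real \<times> real \<Rightarrow> real^'n^'n" and W :: "real^'m^'n" and u0 v0 r :: real
  defines "S \<equiv> {u0-r..u0+r} \<times> {v0-r..v0+r}"
  assumes r: "0 < r" and A: "continuous_on S A" and B: "continuous_on S B"
    and KA: "\<And>p (w :: real^'m^'n). p \<in> S \<Longrightarrow> norm (A p ** w) \<le> K * norm w"
    and KB: "\<And>p (w :: real^'m^'n). p \<in> S \<Longrightarrow> norm (B p ** w) \<le> K * norm w"
    and K: "0 < K" "4 * r * K \<le> 1"
  obtains F :: "real \<times> real \<Rightarrow> real^'m^'n" where "continuous_on S F"
    "\<And>u v. (u, v) \<in> S \<Longrightarrow> F (u, v) =
       W + prim u0 (\<lambda>s. A (s, v0) ** F (s, v0)) u + prim v0 (\<lambda>t. B (u, t) ** F (u, t)) v"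
proof -
  \<comment> \<open>Clamping to \<open>S\<close> lets the operator \<open>T\<close> act on bounded
    continuous functions on the whole plane, a complete type to which the fixed point theorem
    applies.\<close>
  define cu where "cu u = max (u0-r) (min u (u0+r))" for u
  define cv where "cv v = max (v0-r) (min v (v0+r))" for v
  have cu: "cu u \<in> {u0-r..u0+r}" and cv: "cv v \<in> {v0-r..v0+r}" for u v
    using r by (auto simp: cu_def cv_def)
  have u0: "u0 \<in> {u0-r..u0+r}" and v0: "v0 \<in> {v0-r..v0+r}"
    using r by auto
  have ccu: "continuous_on X cu" and ccv: "continuous_on X cv" for X
    unfolding cu_def cv_def by (intro continuous_intros)+
  define T where "T f p = W + prim u0 (\<lambda>s. A (s, v0) ** f (s, v0)) (cu (fst p))
      + prim v0 (\<lambda>t. B (cu (fst p), t) ** f (cu (fst p), t)) (cv (snd p))"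
    for f :: "real \<times> real \<Rightarrow> real^'m^'n" and p
  have cA: "continuous_on {u0-r..u0+r} (\<lambda>s. A (s, v0) ** f (s, v0))"
    if "continuous_on UNIV f" for f :: "real \<times> real \<Rightarrow> real^'m^'n"
    by (rule continuous_on_matrix_mul)
       (use v0 in \<open>auto intro!: continuous_on_compose2[OF A] continuous_on_compose2[OF that] continuous_intros
         simp: S_def\<close>)
  have cB: "continuous_on {v0-r..v0+r} (\<lambda>t. B (cu u, t) ** f (cu u, t))"
    if "continuous_on UNIV f" for f :: "real \<times> real \<Rightarrow> real^'m^'n" and u
    by (rule continuous_on_matrix_mul)
       (use cu[of u] in \<open>auto intro!: continuous_on_compose2[OF B] continuous_on_compose2[OF that] continuous_intros
         simp: S_def\<close>)
  have contT: "continuous_on UNIV (T f)" if f: "continuous_on UNIV f" for f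
  proof -
    have "continuous_on (UNIV \<times> {u0-r..u0+r}) (\<lambda>z. A (snd z, v0) ** f (snd z, v0))"
      by (rule continuous_on_matrix_mul)
         (use v0 in \<open>auto intro!: continuous_on_compose2[OF A] continuous_on_compose2[OF f] continuous_intros
           simp: S_def\<close>)
    then have "continuous_on (UNIV \<times> {u0-r..u0+r}) (\<lambda>(x :: real \<times> real, s). A (s, v0) ** f (s, v0))"
      by (simp add: case_prod_unfold)
    from continuous_on_prim[OF this, where w = "\<lambda>p. cu (fst p)" and b = u0]
    have 1: "continuous_on UNIV (\<lambda>p :: real \<times> real. prim u0 (\<lambda>s. A (s, v0) ** f (s, v0)) (cu (fst p)))"
      using cu u0 by (simp add: continuous_on_compose2[OF ccu[of UNIV]] continuous_on_fst continuous_on_id)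
    have "continuous_on (UNIV \<times> {v0-r..v0+r})
        (\<lambda>z :: (real \<times> real) \<times> real. B (cu (fst (fst z)), snd z) ** f (cu (fst (fst z)), snd z))"
      by (rule continuous_on_matrix_mul)
         (use cu in \<open>auto intro!: continuous_on_compose2[OF B] continuous_on_compose2[OF f]
           continuous_on_compose2[OF ccu[of UNIV]] continuous_intros simp: S_def\<close>)
    then have "continuous_on (UNIV \<times> {v0-r..v0+r})
        (\<lambda>(x :: real \<times> real, t). B (cu (fst x), t) ** f (cu (fst x), t))"
      by (simp add: case_prod_unfold)
    from continuous_on_prim[OF this, where w = "\<lambda>p. cv (snd p)" and b = v0]
    have 2: "continuous_on UNIV (\<lambda>p :: real \<times> real.
        prim v0 (\<lambda>t. B (cu (fst p), t) ** f (cu (fst p), t)) (cv (snd p)))"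
      using cv v0 by (simp add: continuous_on_compose2[OF ccv[of UNIV]] continuous_on_snd continuous_on_id)
    show ?thesis
      unfolding T_def by (intro continuous_on_add continuous_on_const 1 2)
  qed
  \<comment> \<open>Each of the two integrals has length at most \<open>r\<close> and integrand at
    most \<open>K * M\<close>; as \<open>4 * r * K \<le> 1\<close>, each contributes at most
    \<open>M / 4\<close>.\<close>
  have lipT: "norm (T f p - T g p) \<le> M / 2"
    if f: "continuous_on UNIV f" and g: "continuous_on UNIV g"
      and M: "\<And>p. norm (f p - g p) \<le> M" for f g p M
  proof -
    have M0: "0 \<le> M"
      using M[of p] norm_ge_zero order_trans by blast
    have diff: "a ** b - a ** c = a ** (b - c)" for a :: "real^'n^'n" and b c :: "real^'m^'n"
      by (simp add: bounded_bilinear.diff_right[OF bounded_bilinear_matrix_mul])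
    have b: "norm (A q ** f q - A q ** g q) \<le> K * M" "norm (B q ** f q - B q ** g q) \<le> K * M"
      if "q \<in> S" for q
      unfolding diff using KA[OF that, of "f q - g q"] KB[OF that, of "f q - g q"] M[of q] K(1)
      by (meson mult_left_mono order_trans less_imp_le)+
    have rb: "a * (K * M) \<le> M / 4" if "a \<le> r" for a
    proof -
      have "a * (K * M) \<le> r * (K * M)"
        using that K(1) M0 by (intro mult_right_mono) auto
      also have "\<dots> = (4 * r * K) * (M / 4)"
        by simp
      also have "\<dots> \<le> 1 * (M / 4)"
        using K(2) M0 by (intro mult_right_mono) auto
      finally show ?thesis by simp
    qed
    let ?a = "\<lambda>f s. A (s, v0) ** f (s, v0)" and ?b = "\<lambda>f t. B (cu (fst p), t) ** f (cu (fst p), t)"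
    have "norm (prim u0 (\<lambda>s. ?a f s - ?a g s) (cu (fst p))) \<le> \<bar>cu (fst p) - u0\<bar> * (K * M)"
      by (rule norm_prim_le[OF continuous_on_diff[OF cA[OF f] cA[OF g]] u0 cu])
         (use b v0 in \<open>auto simp: S_def\<close>)
    also have "\<dots> \<le> M / 4"
      by (rule rb) (use cu[of "fst p"] in auto)
    finally have 1: "norm (prim u0 (?a f) (cu (fst p)) - prim u0 (?a g) (cu (fst p))) \<le> M / 4"
      by (simp add: prim_diff[OF cA[OF f] cA[OF g] u0 cu])
    have "norm (prim v0 (\<lambda>t. ?b f t - ?b g t) (cv (snd p))) \<le> \<bar>cv (snd p) - v0\<bar> * (K * M)"
      by (rule norm_prim_le[OF continuous_on_diff[OF cB[OF f] cB[OF g]] v0 cv])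
         (use b cu[of "fst p"] in \<open>auto simp: S_def\<close>)
    also have "\<dots> \<le> M / 4"
      by (rule rb) (use cv[of "snd p"] in auto)
    finally have 2: "norm (prim v0 (?b f) (cv (snd p)) - prim v0 (?b g) (cv (snd p))) \<le> M / 4"
      by (simp add: prim_diff[OF cB[OF f] cB[OF g] v0 cv])
    have "T f p - T g p = (prim u0 (?a f) (cu (fst p)) - prim u0 (?a g) (cu (fst p)))
        + (prim v0 (?b f) (cv (snd p)) - prim v0 (?b g) (cv (snd p)))"
      by (simp add: T_def)
    then show ?thesis
      using norm_triangle_mono[OF 1 2] by simp
  qed
  \<comment> \<open>Comparing \<open>T f\<close> with the constant \<open>W\<close> through the
    Lipschitz estimate shows that \<open>T f\<close> is bounded.\<close>
  have T0: "T (\<lambda>_. 0) p = W" for p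
    by (simp add: T_def prim_def bounded_bilinear.zero_right[OF bounded_bilinear_matrix_mul])
  have inT: "T (apply_bcontfun f) \<in> bcontfun" for f
  proof (rule bcontfun_normI)
    show "continuous_on UNIV (T (apply_bcontfun f))"
      by (rule contT) simp
    fix p
    have "norm (T (apply_bcontfun f) p - T (\<lambda>_. 0) p) \<le> norm f / 2"
      by (rule lipT) (auto simp: norm_bounded)
    then have "norm (T (apply_bcontfun f) p - W) \<le> norm f / 2"
      by (simp add: T0)
    then show "norm (T (apply_bcontfun f) p) \<le> norm W + norm f / 2"
      using norm_triangle_ineq2[of "T (apply_bcontfun f) p" W] by linarith
  qed
  have ap: "apply_bcontfun (Bcontfun (T (apply_bcontfun f))) = T (apply_bcontfun f)" for f
    by (rule Bcontfun_inverse[OF inT])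
  have "\<exists>!f. Bcontfun (T (apply_bcontfun f)) = f"
  proof (rule banach_fix_type[where c = "1/2"])
    show "\<forall>f g. dist (Bcontfun (T (apply_bcontfun f))) (Bcontfun (T (apply_bcontfun g))) \<le> 1/2 * dist f g"
    proof (intro allI dist_bound)
      fix f g :: "(real \<times> real) \<Rightarrow>\<^sub>C (real^'m^'n)" and p
      have "norm (T (apply_bcontfun f) p - T (apply_bcontfun g) p) \<le> dist f g / 2"
        by (rule lipT) (auto simp: dist_norm[symmetric] dist_bounded)
      then show "dist (apply_bcontfun (Bcontfun (T (apply_bcontfun f))) p)
          (apply_bcontfun (Bcontfun (T (apply_bcontfun g))) p) \<le> 1/2 * dist f g"
        by (simp add: ap dist_norm)
    qed
  qed auto
  then obtain f where "Bcontfun (T (apply_bcontfun f)) = f"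
    by blast
  then have fp: "apply_bcontfun f = T (apply_bcontfun f)"
    using ap[of f] by simp
  show thesis
  proof (rule that[of "apply_bcontfun f"])
    fix u v assume "(u, v) \<in> S"
    then have "cu u = u" "cv v = v"
      by (auto simp: S_def cu_def cv_def)
    then show "apply_bcontfun f (u, v) = W + prim u0 (\<lambda>s. A (s, v0) ** apply_bcontfun f (s, v0)) u
        + prim v0 (\<lambda>t. B (u, t) ** apply_bcontfun f (u, t)) v"
      by (subst fp) (simp add: T_def)
  qed simp
qed

lemma open_contains_closed_square:
  assumes "open D" "(u0, v0) \<in> D"
  obtains R :: real where "R > 0" "{u0-R..u0+R} \<times> {v0-R..v0+R} \<subseteq> D"
proof -
  obtain X Y where XY: "open X" "open Y" "(u0, v0) \<in> X \<times> Y" "X \<times> Y \<subseteq> D"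
    by (rule open_prod_elim[OF assms])
  obtain a where a: "a > 0" "cball u0 a \<subseteq> X"
    using XY by (auto simp: open_contains_cball)
  obtain b where b: "b > 0" "cball v0 b \<subseteq> Y"
    using XY by (auto simp: open_contains_cball)
  have "{u0 - min a b..u0 + min a b} \<subseteq> cball u0 a" "{v0 - min a b..v0 + min a b} \<subseteq> cball v0 b"
    by (auto simp: dist_real_def)
  then have "{u0 - min a b..u0 + min a b} \<times> {v0 - min a b..v0 + min a b} \<subseteq> D"
    using a(2) b(2) XY(4) by blast
  with that[of "min a b"] a(1) b(1) show thesis
    by simp
qed

text \<open>With \<open>F\<close> the solution of the path integral equation, \<open>F\<^sub>v = B F\<close> holds by
  construction; \<open>\<Delta> = F - H\<close>, where \<open>H\<close> integrates \<open>A F\<close> horizontally,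
  satisfies \<open>\<Delta>\<^sub>v = B \<Delta> - \<integral> B\<^sub>u \<Delta> du\<close> by compatibility, and vanishes for \<open>v = v0\<close>,
  hence everywhere on a small square.\<close>

lemma linear_frobenius:
  fixes A B :: "real \<times> real \<Rightarrow> real^'n^'n" and W :: "real^'m^'n" and u0 v0 :: real
  assumes D: "open D" "(u0, v0) \<in> D" and A: "smooth2_on D A" and B: "smooth2_on D B"
    and compat: "\<And>p. p \<in> D \<Longrightarrow> pv A p + A p ** B p = pu B p + B p ** A p"
  obtains F :: "real \<times> real \<Rightarrow> real^'m^'n" and r :: real where "r > 0"
    "{u0-r..u0+r} \<times> {v0-r..v0+r} \<subseteq> D" "F (u0, v0) = W"
    "smooth2_on ({u0-r<..<u0+r} \<times> {v0-r<..<v0+r}) F"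
    "\<And>p. p \<in> {u0-r<..<u0+r} \<times> {v0-r<..<v0+r} \<Longrightarrow> pu F p = A p ** F p \<and> pv F p = B p ** F p"
proof -
  obtain R where R: "R > 0" "{u0-R..u0+R} \<times> {v0-R..v0+R} \<subseteq> D"
    by (rule open_contains_closed_square[OF D])
  let ?S = "{u0-R..u0+R} \<times> {v0-R..v0+R}"
  have cS: "compact ?S"
    by (intro compact_Times compact_Icc)
  have con: "continuous_on D A" "continuous_on D B" "continuous_on D (pu B)" "continuous_on D (pv A)"
    using A B by (auto intro!: smooth2_on_continuous smooth2_on_pu smooth2_on_pv)
  obtain KA where KA: "KA > 0" "\<And>p (w :: real^'m^'n). p \<in> ?S \<Longrightarrow> norm (A p ** w) \<le> KA * norm w"
    using matrix_mul_bounded[OF cS continuous_on_subset[OF con(1) R(2)]] by blast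
  obtain KB where KB: "KB > 0" "\<And>p (w :: real^'m^'n). p \<in> ?S \<Longrightarrow> norm (B p ** w) \<le> KB * norm w"
    using matrix_mul_bounded[OF cS continuous_on_subset[OF con(2) R(2)]] by blast
  obtain KC where KC: "KC > 0" "\<And>p (w :: real^'m^'n). p \<in> ?S \<Longrightarrow> norm (pu B p ** w) \<le> KC * norm w"
    using matrix_mul_bounded[OF cS continuous_on_subset[OF con(3) R(2)]] by blast
  define K where "K = KA + KB + KC"
  have K: "K > 0" "KA \<le> K" "KB \<le> K" "KC \<le> K"
    using KA KB KC by (auto simp: K_def)
  \<comment> \<open>The bound \<open>1 / (4 * K)\<close> serves the contraction and, again, the
    estimate of the defect; \<open>r \<le> 1\<close> allows the inner integral of the defect
    equation to be bounded without its length.\<close>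
  define r where "r = min (min R 1) (1 / (4 * K))"
  have r: "r > 0" "r \<le> R" "r \<le> 1" "4 * r * K \<le> 1"
  proof -
    have "r \<le> 1 / (4 * K)"
      by (simp add: r_def)
    then have "r * (4 * K) \<le> 1"
      using K(1) by (simp add: pos_le_divide_eq)
    then show "4 * r * K \<le> 1"
      by (simp add: mult_ac)
  qed (use R(1) K(1) in \<open>auto simp: r_def\<close>)
  define I where "I = {u0-r..u0+r}"
  define J where "J = {v0-r..v0+r}"
  have IJ: "I \<times> J \<subseteq> ?S" "I \<times> J \<subseteq> D"
    using r R(2) by (auto simp: I_def J_def)
  have u0: "u0 \<in> I" and v0: "v0 \<in> J"
    using r by (auto simp: I_def J_def)
  have bd: "norm (A p ** w) \<le> K * norm w" "norm (B p ** w) \<le> K * norm w" "norm (pu B p ** w) \<le> K * norm w"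
    if "p \<in> I \<times> J" for p and w :: "real^'m^'n"
  proof -
    have "p \<in> ?S"
      using that IJ(1) by blast
    note b = KA(2)[OF this, of w] KB(2)[OF this, of w] KC(2)[OF this, of w]
    show "norm (A p ** w) \<le> K * norm w" "norm (B p ** w) \<le> K * norm w" "norm (pu B p ** w) \<le> K * norm w"
      using b K(2-4) by (meson mult_right_mono norm_ge_zero order_trans)+
  qed
  have cA: "continuous_on (I \<times> J) A" and cB: "continuous_on (I \<times> J) B"
    and cBu: "continuous_on (I \<times> J) (pu B)" and cAv: "continuous_on (I \<times> J) (pv A)"
    using con continuous_on_subset IJ(2) by blast+
  obtain F where cF: "continuous_on (I \<times> J) F" and F: "\<And>u v. (u, v) \<in> I \<times> J \<Longrightarrow> F (u, v) =
       W + prim u0 (\<lambda>s. A (s, v0) ** F (s, v0)) u + prim v0 (\<lambda>t. B (u, t) ** F (u, t)) v"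
    using path_integral_equation[of r u0 v0 A B K W] r K(1) cA cB bd(1,2) unfolding I_def J_def by blast
  have slice_u: "continuous_on I (\<lambda>s. f (s, v))" if "continuous_on (I \<times> J) f" "v \<in> J"
    for f :: "real \<times> real \<Rightarrow> 'z::topological_space" and v
    by (rule continuous_on_compose2[OF that(1)]) (use that in \<open>auto intro!: continuous_intros\<close>)
  have slice_v: "continuous_on J (\<lambda>t. f (u, t))" if "continuous_on (I \<times> J) f" "u \<in> I"
    for f :: "real \<times> real \<Rightarrow> 'z::topological_space" and u
    by (rule continuous_on_compose2[OF that(1)]) (use that in \<open>auto intro!: continuous_intros\<close>)
  have swap: "continuous_on (J \<times> I) (\<lambda>(v, s). f (s, v))" if "continuous_on (I \<times> J) f"
    for f :: "real \<times> real \<Rightarrow> 'z::topological_space"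
    unfolding case_prod_unfold
    by (rule continuous_on_compose2[OF that]) (auto intro!: continuous_intros)
  note prod_vd = bounded_bilinear.has_vector_derivative[OF bounded_bilinear_matrix_mul]
  have dA: "((\<lambda>t. A (u, t)) has_vector_derivative pv A (u, v)) (at v within J)"
    if "u \<in> I" "v \<in> J" for u v
  proof -
    have "(u, v) \<in> D"
      using that IJ(2) by blast
    from has_vector_derivative_pv[OF smooth2_on_differentiable[OF A this]] show ?thesis
      by (simp add: has_vector_derivative_at_within)
  qed
  have dB: "((\<lambda>s. B (s, v)) has_vector_derivative pu B (u, v)) (at u within I)"
    if "u \<in> I" "v \<in> J" for u v
  proof -
    have "(u, v) \<in> D"
      using that IJ(2) by blast
    from has_vector_derivative_pu[OF smooth2_on_differentiable[OF B this]] show ?thesis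
      by (simp add: has_vector_derivative_at_within)
  qed
  have Fv: "((\<lambda>t. F (u, t)) has_vector_derivative B (u, v) ** F (u, v)) (at v within J)"
    if u: "u \<in> I" and v: "v \<in> J" for u v
  proof -
    have "(prim v0 (\<lambda>t. B (u, t) ** F (u, t)) has_vector_derivative B (u, v) ** F (u, v)) (at v within J)"
      using slice_v[OF continuous_on_matrix_mul[OF cB cF] u] v0 v unfolding J_def
      by (rule has_vector_derivative_prim)
    from has_vector_derivative_add[OF has_vector_derivative_const this]
    have "((\<lambda>t. (W + prim u0 (\<lambda>s. A (s, v0) ** F (s, v0)) u) + prim v0 (\<lambda>t. B (u, t) ** F (u, t)) t)
        has_vector_derivative B (u, v) ** F (u, v)) (at v within J)"
      by simp
    then show ?thesis
      by (rule has_vector_derivative_transform[OF v, rotated]) (use F u in auto)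
  qed
  define H where "H u v = F (u0, v) + prim u0 (\<lambda>s. A (s, v) ** F (s, v)) u" for u v
  have Hu: "((\<lambda>u. H u v) has_vector_derivative A (u, v) ** F (u, v)) (at u within I)"
    if u: "u \<in> I" and v: "v \<in> J" for u v
  proof -
    have "(prim u0 (\<lambda>s. A (s, v) ** F (s, v)) has_vector_derivative A (u, v) ** F (u, v)) (at u within I)"
      using slice_u[OF continuous_on_matrix_mul[OF cA cF] v] u0 u unfolding I_def
      by (rule has_vector_derivative_prim)
    from has_vector_derivative_add[OF has_vector_derivative_const this] show ?thesis
      by (simp add: H_def)
  qed
  have "continuous_on (I \<times> J) (\<lambda>p. F (u0, snd p) + prim u0 (\<lambda>s. A (s, snd p) ** F (s, snd p)) (fst p))"
  proof (rule continuous_on_add)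
    show "continuous_on (I \<times> J) (\<lambda>p. F (u0, snd p))"
      by (rule continuous_on_compose2[OF cF]) (use u0 in \<open>auto intro!: continuous_intros\<close>)
    have "continuous_on ((I \<times> J) \<times> I) (\<lambda>z. (\<lambda>q. A q ** F q) (snd z, snd (fst z)))"
      by (rule continuous_on_compose2[OF continuous_on_matrix_mul[OF cA cF]])
         (auto intro!: continuous_intros)
    then have "continuous_on ((I \<times> J) \<times> I) (\<lambda>(p, s). A (s, snd p) ** F (s, snd p))"
      by (simp add: case_prod_unfold)
    then show "continuous_on (I \<times> J) (\<lambda>p. prim u0 (\<lambda>s. A (s, snd p) ** F (s, snd p)) (fst p))"
      using u0 unfolding I_def by (intro continuous_on_prim) (auto intro!: continuous_intros)
  qed
  then have cH: "continuous_on (I \<times> J) (\<lambda>p. H (fst p) (snd p))"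
    by (simp add: H_def)
  define \<Delta> where "\<Delta> p = F p - H (fst p) (snd p)" for p
  have c\<Delta>: "continuous_on (I \<times> J) \<Delta>"
    unfolding \<Delta>_def by (intro continuous_on_diff cF cH)
  define X where "X p = (pu B p + B p ** A p) ** F p" for p
  have cX: "continuous_on (I \<times> J) X"
    unfolding X_def by (intro continuous_on_matrix_mul continuous_on_add cBu cB cA cF)
  have Hv: "((\<lambda>v. H u v) has_vector_derivative
      B (u, v) ** H u v + prim u0 (\<lambda>s. pu B (s, v) ** \<Delta> (s, v)) u) (at v within J)"
    if u: "u \<in> I" and v: "v \<in> J" for u v
  proof -
    have "((\<lambda>v. prim u0 (\<lambda>s. A (s, v) ** F (s, v)) u) has_vector_derivative prim u0 (\<lambda>s. X (s, v)) u) (at v within J)"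
    proof (rule prim_leibniz)
      fix v s assume vs: "v \<in> J" "s \<in> {u0-r..u0+r}"
      then have s: "s \<in> I" and D: "(s, v) \<in> D"
        using IJ(2) by (auto simp: I_def)
      \<comment> \<open>Compatibility enters here: with \<open>pv F = B F\<close> already known, the
        \<open>v\<close>-derivative of \<open>A F\<close> is rewritten without
        \<open>pv A\<close>.\<close>
      have "A (s, v) ** (B (s, v) ** F (s, v)) + pv A (s, v) ** F (s, v) = (pv A (s, v) + A (s, v) ** B (s, v)) ** F (s, v)"
        by (simp add: matrix_mul_assoc bounded_bilinear.add_left[OF bounded_bilinear_matrix_mul] add.commute)
      also have "\<dots> = X (s, v)"
        by (simp add: compat[OF D] X_def)
      finally show "((\<lambda>v. A (s, v) ** F (s, v)) has_vector_derivative X (s, v)) (at v within J)"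
        using prod_vd[OF dA[OF s vs(1)] Fv[OF s vs(1)]] by simp
    next
      show "continuous_on {u0-r..u0+r} (\<lambda>s. A (s, v) ** F (s, v))" if "v \<in> J" for v
        using slice_u[OF continuous_on_matrix_mul[OF cA cF] that] by (simp add: I_def)
      show "continuous_on (J \<times> {u0-r..u0+r}) (\<lambda>(v, s). X (s, v))"
        using swap[OF cX] by (simp add: I_def)
    qed (use u u0 v in \<open>auto simp: I_def J_def\<close>)
    from has_vector_derivative_add[OF Fv[OF u0 v] this]
    have 1: "((\<lambda>v. H u v) has_vector_derivative B (u0, v) ** F (u0, v) + prim u0 (\<lambda>s. X (s, v)) u) (at v within J)"
      by (simp add: H_def)
    \<comment> \<open>\<open>?Y\<close> is the \<open>u\<close>-derivative of \<open>B H\<close>.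
      Its integral trades the boundary term at \<open>u0\<close> for \<open>B H\<close> at
      \<open>u\<close>, and its difference from \<open>X\<close> contains \<open>F\<close> and
      \<open>H\<close> only through \<Delta>.\<close>
    let ?Y = "\<lambda>s. B (s, v) ** (A (s, v) ** F (s, v)) + pu B (s, v) ** H s v"
    have cY: "continuous_on I ?Y"
      using slice_u[OF continuous_on_add[OF continuous_on_matrix_mul[OF cB continuous_on_matrix_mul[OF cA cF]]
            continuous_on_matrix_mul[OF cBu cH]] v] by simp
    have "prim u0 ?Y u = B (u, v) ** H u v - B (u0, v) ** H u0 v"
      by (rule prim_eq_diff[of "u0-r" "u0+r"])
         (use cY u u0 prod_vd[OF dB[OF _ v] Hu[OF _ v]] in \<open>auto simp: I_def\<close>)
    then have 2: "B (u0, v) ** F (u0, v) = B (u, v) ** H u v - prim u0 ?Y u"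
      by (simp add: H_def)
    have "prim u0 (\<lambda>s. X (s, v)) u - prim u0 ?Y u = prim u0 (\<lambda>s. X (s, v) - ?Y s) u"
      using prim_diff[of "u0-r" "u0+r" "\<lambda>s. X (s, v)" ?Y u0 u] slice_u[OF cX v] cY u u0
      by (simp add: I_def)
    also have "(\<lambda>s. X (s, v) - ?Y s) = (\<lambda>s. pu B (s, v) ** \<Delta> (s, v))"
      by (simp add: X_def \<Delta>_def bounded_bilinear.add_left[OF bounded_bilinear_matrix_mul] matrix_mul_assoc
          bounded_bilinear.diff_right[OF bounded_bilinear_matrix_mul])
    finally show ?thesis
      using 1 2 by (simp add: algebra_simps)
  qed
  have \<Delta>v: "((\<lambda>v. \<Delta> (u, v)) has_vector_derivative
      B (u, v) ** \<Delta> (u, v) - prim u0 (\<lambda>s. pu B (s, v) ** \<Delta> (s, v)) u) (at v within J)"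
    if u: "u \<in> I" and v: "v \<in> J" for u v
    using has_vector_derivative_diff[OF Fv[OF u v] Hv[OF u v]]
    by (simp add: \<Delta>_def bounded_bilinear.diff_right[OF bounded_bilinear_matrix_mul] algebra_simps)
  \<comment> \<open>On the base line the vertical integral is empty, so \<open>F\<close> and
    \<open>H\<close> are both \<open>W\<close> plus the same horizontal integral.\<close>
  have \<Delta>0: "\<Delta> (u, v0) = 0" if "u \<in> I" for u
    using F[of u v0] F[of u0 v0] that u0 v0 by (simp add: \<Delta>_def H_def)
  have "compact (I \<times> J)"
    unfolding I_def J_def by (intro compact_Times compact_Icc)
  moreover have "I \<times> J \<noteq> {}"
    using u0 v0 by blast
  ultimately obtain q where q: "q \<in> I \<times> J" "\<And>p. p \<in> I \<times> J \<Longrightarrow> norm (\<Delta> p) \<le> norm (\<Delta> q)"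
    using continuous_attains_sup[OF _ _ continuous_on_norm[OF c\<Delta>]] by blast
  define M where "M = norm (\<Delta> q)"
  have M: "norm (\<Delta> p) \<le> M" if "p \<in> I \<times> J" for p
    using q(2)[OF that] by (simp add: M_def)
  have bM: "norm (B p ** \<Delta> p) \<le> K * M" "norm (pu B p ** \<Delta> p) \<le> K * M" if "p \<in> I \<times> J" for p
    using bd(2,3)[OF that, of "\<Delta> p"] M[OF that] K(1) by (meson mult_left_mono order_trans less_imp_le)+
  have M0: "0 \<le> K * M"
    using K(1) by (simp add: M_def)
  \<comment> \<open>The mean value inequality along the vertical segment from the base line to the
    maximum point \<open>q\<close>: one \<open>K * M\<close> comes from \<open>B\<close>, the other
    from the integral of \<open>pu B\<close>. With \<open>4 * r * K \<le> 1\<close> this gives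
    \<open>M \<le> M / 2\<close>.\<close>
  have "M \<le> 2 * K * M * r"
  proof -
    obtain u v where uv: "q = (u, v)" "u \<in> I" "v \<in> J"
      using q(1) by auto
    let ?d = "\<lambda>v. B (u, v) ** \<Delta> (u, v) - prim u0 (\<lambda>s. pu B (s, v) ** \<Delta> (s, v)) u"
    have nd: "norm (?d t) \<le> 2 * K * M" if t: "t \<in> J" for t
    proof -
      have "norm (prim u0 (\<lambda>s. pu B (s, t) ** \<Delta> (s, t)) u) \<le> \<bar>u - u0\<bar> * (K * M)"
        by (rule norm_prim_le[of "u0-r" "u0+r"])
           (use slice_u[OF continuous_on_matrix_mul[OF cBu c\<Delta>] t] uv(2) u0 bM(2) t in \<open>auto simp: I_def\<close>)
      also have "\<dots> \<le> 1 * (K * M)"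
        using uv(2) r(3) M0 by (intro mult_right_mono) (auto simp: I_def)
      finally have "norm (prim u0 (\<lambda>s. pu B (s, t) ** \<Delta> (s, t)) u) \<le> K * M"
        by simp
      moreover have "norm (B (u, t) ** \<Delta> (u, t)) \<le> K * M"
        using bM(1) uv(2) t by blast
      ultimately show ?thesis
        using norm_triangle_ineq4[of "B (u, t) ** \<Delta> (u, t)" "prim u0 (\<lambda>s. pu B (s, t) ** \<Delta> (s, t)) u"]
        by linarith
    qed
    have "norm (\<Delta> (u, v) - \<Delta> (u, v0)) \<le> (2 * K * M) * norm (v - v0)"
    proof (rule differentiable_bound[where f' = "\<lambda>t h. h *\<^sub>R ?d t"])
      show "((\<lambda>v. \<Delta> (u, v)) has_derivative (\<lambda>h. h *\<^sub>R ?d t)) (at t within J)" if "t \<in> J" for t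
        using \<Delta>v[OF uv(2) that] by (simp add: has_vector_derivative_def)
      show "onorm (\<lambda>h. h *\<^sub>R ?d t) \<le> 2 * K * M" if "t \<in> J" for t
        by (rule onorm_bound) (use M0 nd[OF that] in \<open>auto simp: mult.commute[of "\<bar>_\<bar>"] intro: mult_right_mono\<close>)
    qed (use uv v0 in \<open>auto simp: J_def\<close>)
    also have "\<dots> \<le> (2 * K * M) * r"
      using uv(3) M0 by (intro mult_left_mono) (auto simp: J_def)
    finally show ?thesis
      by (simp add: \<Delta>0[OF uv(2)] M_def uv(1))
  qed
  also have "\<dots> = (4 * r * K) * (M / 2)"
    by simp
  also have "\<dots> \<le> 1 * (M / 2)"
    using r(4) by (intro mult_right_mono) (auto simp: M_def)
  finally have "M = 0"
    using norm_ge_zero[of "\<Delta> q"] by (simp add: M_def)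
  then have FH: "F p = H (fst p) (snd p)" if "p \<in> I \<times> J" for p
    using M[OF that] by (simp add: \<Delta>_def)
  let ?O = "{u0-r<..<u0+r} \<times> {v0-r<..<v0+r}"
  have O: "open ?O"
    by (intro open_Times open_greaterThanLessThan)
  have OI: "?O \<subseteq> I \<times> J"
    by (auto simp: I_def J_def)
  \<comment> \<open>Since \<open>F\<close> equals \<open>H\<close>, it inherits the
    \<open>u\<close>-derivative of \<open>H\<close>; in the open square the one-sided qualification
    disappears.\<close>
  have pu: "((\<lambda>t. F (t, snd p)) has_vector_derivative A p ** F p) (at (fst p))" if "p \<in> ?O" for p
  proof -
    obtain u v where uv: "p = (u, v)"
      by (cases p)
    then have p: "p = (u, v)" "u \<in> I" "v \<in> J" "u0 - r < u" "u < u0 + r"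
      using that by (auto simp: I_def J_def)
    have "((\<lambda>u. F (u, v)) has_vector_derivative A (u, v) ** F (u, v)) (at u within I)"
      by (rule has_vector_derivative_transform[OF p(2) _ Hu[OF p(2,3)]]) (use FH p(3) in auto)
    then show ?thesis
      using p(4,5) by (simp add: p(1) I_def at_within_Icc_at)
  qed
  have pv: "((\<lambda>t. F (fst p, t)) has_vector_derivative B p ** F p) (at (snd p))" if "p \<in> ?O" for p
  proof -
    obtain u v where uv: "p = (u, v)"
      by (cases p)
    then have p: "p = (u, v)" "u \<in> I" "v \<in> J" "v0 - r < v" "v < v0 + r"
      using that by (auto simp: I_def J_def)
    show ?thesis
      using Fv[OF p(2,3)] p(4,5) by (simp add: p(1) J_def at_within_Icc_at)
  qed
  have smO: "smooth2_on ?O A" "smooth2_on ?O B"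
    using A B OI IJ(2) smooth2_on_subset by blast+
  have cFO: "continuous_on ?O F"
    by (rule continuous_on_subset[OF cF OI])
  have dF: "F differentiable (at p)" if "p \<in> ?O" for p
    by (rule differentiable_of_continuous_partials[OF O that pu pv])
       (use continuous_on_matrix_mul[OF smooth2_on_continuous[OF smO(2)] cFO] in auto)
  \<comment> \<open>Bootstrapping: if \<open>F\<close> has order \<open>k\<close>, so do
    \<open>A F\<close> and \<open>B F\<close>, which are its partial derivatives.\<close>
  have "Ck k ?O F" for k
  proof (induction k)
    case (Suc k)
    have c: "Ck k ?O A" "Ck k ?O B"
      using smO by (simp_all add: smooth2_on_def)
    show ?case
    proof (rule Ck_SucI[OF cFO dF])
      show "Ck k ?O (pu F)"
        by (rule Ck_cong[OF O _ Ck_bilinear[OF bounded_bilinear_matrix_mul O c(1) Suc]])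
           (rule pu_eqI[OF pu, symmetric])
      show "Ck k ?O (pv F)"
        by (rule Ck_cong[OF O _ Ck_bilinear[OF bounded_bilinear_matrix_mul O c(2) Suc]])
           (rule pv_eqI[OF pv, symmetric])
    qed
  qed (simp add: cFO)
  then have "smooth2_on ?O F"
    by (simp add: smooth2_on_def)
  moreover have "F (u0, v0) = W"
    using F[of u0 v0] u0 v0 by simp
  moreover have "{u0-r..u0+r} \<times> {v0-r..v0+r} \<subseteq> D"
    using IJ(2) by (simp add: I_def J_def)
  ultimately show thesis
    using that[of r F] r(1) pu_eqI[OF pu] pv_eqI[OF pv] by blast
qed

section \<open>Uniqueness, Gram matrices and primitives\<close>

text \<open>By Cauchy-Schwarz the squared norm of \<open>f\<close> grows at rate at most
  \<open>2 * C\<close>, so the weight \<open>exp (- (2 * C) * s)\<close> makes it nonincreasing; it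
  starts at zero and is nonnegative.\<close>

lemma gronwall_zero_forward:
  fixes f :: "real \<Rightarrow> 'a::real_inner"
  assumes d: "\<And>t. t \<in> {a<..<b} \<Longrightarrow> (f has_vector_derivative f' t) (at t)"
    and bd: "\<And>t. t \<in> {a<..<b} \<Longrightarrow> norm (f' t) \<le> C * norm (f t)"
    and t: "t0 \<in> {a<..<b}" "f t0 = 0" "t \<in> {a<..<b}" "t0 \<le> t"
  shows "f t = 0"
proof -
  let ?g = "\<lambda>s. exp (- (2 * C) * s) * (f s \<bullet> f s)"
  have "?g t \<le> ?g t0"
  proof (rule DERIV_nonpos_imp_nonincreasing[OF t(4)])
    fix s assume "t0 \<le> s" "s \<le> t"
    then have s: "s \<in> {a<..<b}"
      using t by auto
    have D: "((\<lambda>s. f s \<bullet> f s) has_real_derivative f s \<bullet> f' s + f' s \<bullet> f s) (at s)"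
      unfolding has_real_derivative_iff_has_vector_derivative
      by (rule bounded_bilinear.has_vector_derivative[OF bounded_bilinear_inner d[OF s] d[OF s]])
    have "f s \<bullet> f' s \<le> norm (f s) * norm (f' s)"
      by (rule norm_cauchy_schwarz)
    also have "\<dots> \<le> norm (f s) * (C * norm (f s))"
      by (rule mult_left_mono[OF bd[OF s]]) simp
    also have "\<dots> = C * (f s \<bullet> f s)"
      by (simp add: dot_square_norm power2_eq_square)
    finally have le: "f s \<bullet> f' s \<le> C * (f s \<bullet> f s)" .
    have "(?g has_real_derivative exp (- (2 * C) * s) * (2 * (f s \<bullet> f' s - C * (f s \<bullet> f s)))) (at s)"
      by (rule derivative_eq_intros D refl)+ (simp add: inner_commute algebra_simps)
    moreover have "exp (- (2 * C) * s) * (2 * (f s \<bullet> f' s - C * (f s \<bullet> f s))) \<le> 0"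
      using le by (simp add: mult_le_0_iff)
    ultimately show "\<exists>y. (?g has_real_derivative y) (at s) \<and> y \<le> 0"
      by blast
  qed
  then have "f t \<bullet> f t \<le> 0"
    using t(2) by (simp add: mult_le_0_iff)
  then show ?thesis
    using inner_ge_zero[of "f t"] by (simp add: order_antisym)
qed

text \<open>For earlier times the reflected curve \<open>f (- t)\<close> obeys the same bound and
  the forward case applies.\<close>

lemma gronwall_zero:
  fixes f :: "real \<Rightarrow> 'a::real_inner"
  assumes d: "\<And>t. t \<in> {a<..<b} \<Longrightarrow> (f has_vector_derivative f' t) (at t)"
    and bd: "\<And>t. t \<in> {a<..<b} \<Longrightarrow> norm (f' t) \<le> C * norm (f t)"
    and t: "t0 \<in> {a<..<b}" "f t0 = 0" "t \<in> {a<..<b}"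
  shows "f t = 0"
proof (cases "t0 \<le> t")
  case True
  then show ?thesis
    using gronwall_zero_forward[OF d bd t] by blast
next
  case False
  have "((\<lambda>t. f (- t)) has_vector_derivative - f' (- t)) (at t)" if "t \<in> {-b<..<-a}" for t
  proof -
    have "(uminus has_vector_derivative - 1) (at t)"
      by (auto intro!: derivative_eq_intros)
    moreover have "(f has_vector_derivative f' (- t)) (at (- t))"
      by (rule d) (use that in auto)
    ultimately show ?thesis
      using vector_diff_chain_at[of uminus "- 1" t f "f' (- t)"] by (simp add: o_def)
  qed
  then have "f (- (- t)) = 0"
    by (rule gronwall_zero_forward[of "-b" "-a" "\<lambda>t. f (- t)" "\<lambda>t. - f' (- t)" C "- t0" "- t"])
       (use False t bd in auto)
  then show ?thesis
    by simp
qed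

text \<open>Gronwall along the horizontal segment through \<open>q\<close>, then along the vertical
  one to \<open>p\<close>; a rectangle contains both. The case \<open>C = 0\<close> says that a
  vanishing gradient forces a constant.\<close>

lemma zero_of_partials_bounded:
  fixes W :: "real \<times> real \<Rightarrow> 'a::real_inner"
    and a b c d :: real
  defines "R \<equiv> {a<..<b} \<times> {c<..<d}"
  assumes W: "\<And>p. p \<in> R \<Longrightarrow> W differentiable (at p)"
    and bu: "\<And>p. p \<in> R \<Longrightarrow> norm (pu W p) \<le> C * norm (W p)"
    and bv: "\<And>p. p \<in> R \<Longrightarrow> norm (pv W p) \<le> C * norm (W p)"
    and q: "q \<in> R" "W q = 0" and p: "p \<in> R"
  shows "W p = 0"
proof -
  obtain u v u0 v0 where pq: "p = (u, v)" "q = (u0, v0)"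
    by (cases p, cases q)
  have m: "u \<in> {a<..<b}" "u0 \<in> {a<..<b}" "v \<in> {c<..<d}" "v0 \<in> {c<..<d}"
    using p q(1) by (auto simp: pq R_def)
  have "W (u, v0) = 0"
  proof (rule gronwall_zero[of a b "\<lambda>t. W (t, v0)" "\<lambda>t. pu W (t, v0)" C u0 u])
    fix t assume "t \<in> {a<..<b}"
    then have "(t, v0) \<in> R"
      using m by (simp add: R_def)
    from has_vector_derivative_pu[OF W[OF this]] bu[OF this]
    show "((\<lambda>t. W (t, v0)) has_vector_derivative pu W (t, v0)) (at t)"
      "norm (pu W (t, v0)) \<le> C * norm (W (t, v0))"
      by simp_all
  qed (use m q in \<open>auto simp: pq\<close>)
  have "W (u, v) = 0"
  proof (rule gronwall_zero[of c d "\<lambda>t. W (u, t)" "\<lambda>t. pv W (u, t)" C v0 v])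
    fix t assume "t \<in> {c<..<d}"
    then have "(u, t) \<in> R"
      using m by (simp add: R_def)
    from has_vector_derivative_pv[OF W[OF this]] bv[OF this]
    show "((\<lambda>t. W (u, t)) has_vector_derivative pv W (u, t)) (at t)"
      "norm (pv W (u, t)) \<le> C * norm (W (u, t))"
      by simp_all
  qed (use m \<open>W (u, v0) = 0\<close> in auto)
  then show ?thesis
    by (simp add: pq)
qed

lemma pu_diff:
  "f differentiable (at p) \<Longrightarrow> g differentiable (at p) \<Longrightarrow> pu (\<lambda>q. f q - g q) p = pu f p - pu g p"
  by (rule pu_eqI, rule has_vector_derivative_diff; rule has_vector_derivative_pu)

lemma pv_diff:
  "f differentiable (at p) \<Longrightarrow> g differentiable (at p) \<Longrightarrow> pv (\<lambda>q. f q - g q) p = pv f p - pv g p"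
  by (rule pv_eqI, rule has_vector_derivative_diff; rule has_vector_derivative_pv)

lemma linear_system_unique:
  fixes A B :: "real \<times> real \<Rightarrow> real^'n^'n" and F G :: "real \<times> real \<Rightarrow> real^'m^'n"
    and a b c d :: real
  defines "R \<equiv> {a<..<b} \<times> {c<..<d}"
  assumes A: "continuous_on ({a..b} \<times> {c..d}) A" and B: "continuous_on ({a..b} \<times> {c..d}) B"
    and F: "\<And>p. p \<in> R \<Longrightarrow> F differentiable (at p) \<and> pu F p = A p ** F p \<and> pv F p = B p ** F p"
    and G: "\<And>p. p \<in> R \<Longrightarrow> G differentiable (at p) \<and> pu G p = A p ** G p \<and> pv G p = B p ** G p"
    and q: "q \<in> R" "F q = G q" and p: "p \<in> R"
  shows "F p = G p"
proof -
  have S: "compact ({a..b} \<times> {c..d})"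
    by (intro compact_Times compact_Icc)
  have RS: "p \<in> {a..b} \<times> {c..d}" if "p \<in> R" for p
    using that by (auto simp: R_def)
  obtain K where K: "K > 0" "\<And>p (w :: real^'m^'n). p \<in> {a..b} \<times> {c..d} \<Longrightarrow> norm (A p ** w) \<le> K * norm w"
    using matrix_mul_bounded[OF S A] by blast
  obtain L where L: "L > 0" "\<And>p (w :: real^'m^'n). p \<in> {a..b} \<times> {c..d} \<Longrightarrow> norm (B p ** w) \<le> L * norm w"
    using matrix_mul_bounded[OF S B] by blast
  have "F p - G p = 0"
  proof (rule zero_of_partials_bounded[of a b c d "\<lambda>p. F p - G p" "K + L" q p])
    fix p assume "p \<in> {a<..<b} \<times> {c<..<d}"
    then have p: "p \<in> R"
      by (simp add: R_def)
    note f = F[OF p] and g = G[OF p]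
    have "pu (\<lambda>p. F p - G p) p = A p ** (F p - G p)" "pv (\<lambda>p. F p - G p) p = B p ** (F p - G p)"
      using f g by (simp_all add: pu_diff pv_diff bounded_bilinear.diff_right[OF bounded_bilinear_matrix_mul])
    moreover have "K * norm (F p - G p) \<le> (K + L) * norm (F p - G p)" "L * norm (F p - G p) \<le> (K + L) * norm (F p - G p)"
      using K(1) L(1) by (auto intro!: mult_right_mono)
    ultimately show "norm (pu (\<lambda>p. F p - G p) p) \<le> (K + L) * norm (F p - G p)"
      "norm (pv (\<lambda>p. F p - G p) p) \<le> (K + L) * norm (F p - G p)"
      using K(2)[OF RS[OF p], of "F p - G p"] L(2)[OF RS[OF p], of "F p - G p"] by simp_all
    show "(\<lambda>p. F p - G p) differentiable (at p)"
      using f g by (simp add: differentiable_diff)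
  qed (use q p in \<open>simp_all add: R_def\<close>)
  then show ?thesis
    by simp
qed

section \<open>Preservation of the Gram matrix\<close>

lemma bounded_linear_transpose: "bounded_linear (transpose :: real^'n^'m \<Rightarrow> real^'m^'n)"
  by (rule linear_conv_bounded_linear[THEN iffD1])
     (auto intro!: linearI simp: transpose_def vec_eq_iff)

text \<open>The Gram matrix \<open>Q\<close> of the rows satisfies \<open>Q\<^sub>u = A Q + Q A\<^sup>T\<close>, a linear system
  of which the constant \<open>C\<close> is also a solution.\<close>

lemma linear_system_gram:
  fixes A B :: "real \<times> real \<Rightarrow> real^'n^'n" and F :: "real \<times> real \<Rightarrow> real^'m^'n"
    and E :: "real^'m^'m" and C :: "real^'n^'n"
    and a b c d :: real
  defines "R \<equiv> {a<..<b} \<times> {c<..<d}"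
  assumes A: "continuous_on ({a..b} \<times> {c..d}) A" and B: "continuous_on ({a..b} \<times> {c..d}) B"
    and F: "\<And>p. p \<in> R \<Longrightarrow> F differentiable (at p) \<and> pu F p = A p ** F p \<and> pv F p = B p ** F p"
    and CA: "\<And>p. p \<in> R \<Longrightarrow> A p ** C + C ** transpose (A p) = 0"
    and CB: "\<And>p. p \<in> R \<Longrightarrow> B p ** C + C ** transpose (B p) = 0"
    and q: "q \<in> R" "F q ** E ** transpose (F q) = C" and p: "p \<in> R"
  shows "F p ** E ** transpose (F p) = C"
proof -
  note mm = bounded_bilinear_matrix_mul
  note mb = bounded_bilinear.add_left[OF mm] bounded_bilinear.add_right[OF mm]
    bounded_bilinear.diff_left[OF mm] bounded_bilinear.diff_right[OF mm]
  have S: "compact ({a..b} \<times> {c..d})"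
    by (intro compact_Times compact_Icc)
  have RS: "p \<in> {a..b} \<times> {c..d}" if "p \<in> R" for p
    using that by (auto simp: R_def)
  obtain K where K: "K > 0" "\<And>p (w :: real^'n^'n). p \<in> {a..b} \<times> {c..d} \<Longrightarrow> norm (A p ** w) \<le> K * norm w"
    using matrix_mul_bounded[OF S A] by blast
  obtain L where L: "L > 0" "\<And>p (w :: real^'n^'n). p \<in> {a..b} \<times> {c..d} \<Longrightarrow> norm (B p ** w) \<le> L * norm w"
    using matrix_mul_bounded[OF S B] by blast
  obtain T where T: "T > 0" "\<And>x :: real^'n^'n. norm (transpose x) \<le> T * norm x"
    using bounded_linear.pos_bounded[OF bounded_linear_transpose] by (metis mult.commute)
  let ?Q = "\<lambda>p. F p ** E ** transpose (F p)"
  \<comment> \<open>The right multiplication is the transpose of \<open>X ** transpose w\<close>;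
    each of the two transpositions costs a factor \<open>T\<close>.\<close>
  have bound: "norm (X ** w + w ** transpose X) \<le> (1 + T * T) * (K + L) * norm w"
    if X: "\<And>w :: real^'n^'n. norm (X ** w) \<le> M * norm w" and M: "0 \<le> M" "M \<le> K + L" for X w :: "real^'n^'n" and M
  proof -
    have "norm (w ** transpose X) = norm (transpose (X ** transpose w))"
      by (simp add: matrix_transpose_mul transpose_transpose)
    also have "\<dots> \<le> T * (M * (T * norm w))"
      using T(1) M(1) T(2)[of "X ** transpose w"] X[of "transpose w"] T(2)[of w]
      by (meson mult_left_mono order_trans less_imp_le)
    finally have "norm (X ** w + w ** transpose X) \<le> M * norm w + T * (M * (T * norm w))"
      using norm_triangle_mono[OF X[of w]] by blast
    also have "\<dots> = M * ((1 + T * T) * norm w)"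
      by (simp add: algebra_simps)
    also have "\<dots> \<le> (K + L) * ((1 + T * T) * norm w)"
      using M(2) by (rule mult_right_mono) simp
    finally show ?thesis
      by (simp add: mult_ac)
  qed
  have "?Q p - C = 0"
  proof (rule zero_of_partials_bounded[of a b c d "\<lambda>p. ?Q p - C" "(1 + T * T) * (K + L)" q p])
    fix p assume "p \<in> {a<..<b} \<times> {c<..<d}"
    then have p: "p \<in> R"
      by (simp add: R_def)
    note f = F[OF p]
    have d1: "(\<lambda>p. F p ** E) differentiable (at p)"
      using f by (intro differentiable_bilinear_compose[OF mm]) simp_all
    have d2: "(\<lambda>p. transpose (F p)) differentiable (at p)"
      using f by (intro differentiable_linear_compose[OF bounded_linear_transpose]) simp
    have d3: "?Q differentiable (at p)"
      by (rule differentiable_bilinear_compose[OF mm d1 d2])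
    then show "(\<lambda>p. ?Q p - C) differentiable (at p)"
      by (simp add: differentiable_diff)
    have "pu ?Q p = (F p ** E) ** transpose (pu F p) + (pu F p ** E) ** transpose (F p)"
      using f by (simp add: pu_bilinear[OF mm d1 d2] pu_bilinear[OF mm] pu_linear[OF bounded_linear_transpose]
          bounded_bilinear.zero_right[OF mm])
    then have "pu (\<lambda>p. ?Q p - C) p = A p ** ?Q p + ?Q p ** transpose (A p)"
      using f d3 by (simp add: pu_diff matrix_transpose_mul matrix_mul_assoc add.commute)
    \<comment> \<open>By \<open>CA\<close> the same expression vanishes at \<open>C\<close>, so
      \<open>C\<close> may be subtracted.\<close>
    also have "\<dots> = A p ** (?Q p - C) + (?Q p - C) ** transpose (A p)"
      using CA[OF p] by (simp add: mb add.commute add_eq_0_iff)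
    finally have u: "pu (\<lambda>p. ?Q p - C) p = A p ** (?Q p - C) + (?Q p - C) ** transpose (A p)" .
    have "pv ?Q p = (F p ** E) ** transpose (pv F p) + (pv F p ** E) ** transpose (F p)"
      using f by (simp add: pv_bilinear[OF mm d1 d2] pv_bilinear[OF mm] pv_linear[OF bounded_linear_transpose]
          bounded_bilinear.zero_right[OF mm])
    then have "pv (\<lambda>p. ?Q p - C) p = B p ** ?Q p + ?Q p ** transpose (B p)"
      using f d3 by (simp add: pv_diff matrix_transpose_mul matrix_mul_assoc add.commute)
    also have "\<dots> = B p ** (?Q p - C) + (?Q p - C) ** transpose (B p)"
      using CB[OF p] by (simp add: mb add.commute add_eq_0_iff)
    finally have v: "pv (\<lambda>p. ?Q p - C) p = B p ** (?Q p - C) + (?Q p - C) ** transpose (B p)" .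
    show "norm (pu (\<lambda>p. ?Q p - C) p) \<le> (1 + T * T) * (K + L) * norm (?Q p - C)"
      unfolding u by (rule bound[of _ K]) (use K L RS[OF p] in auto)
    show "norm (pv (\<lambda>p. ?Q p - C) p) \<le> (1 + T * T) * (K + L) * norm (?Q p - C)"
      unfolding v by (rule bound[of _ L]) (use K L RS[OF p] in auto)
  qed (use q p in \<open>simp_all add: R_def\<close>)
  then show ?thesis
    by simp
qed

section \<open>Primitives of closed one-forms\<close>

lemma smooth2_on_partialsI:
  assumes D: "open D"
    and u: "\<And>q. q \<in> D \<Longrightarrow> ((\<lambda>t. f (t, snd q)) has_vector_derivative fu q) (at (fst q))"
    and v: "\<And>q. q \<in> D \<Longrightarrow> ((\<lambda>t. f (fst q, t)) has_vector_derivative fv q) (at (snd q))"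
    and s: "smooth2_on D fu" "smooth2_on D fv"
  shows "smooth2_on D f"
proof -
  have d: "f differentiable (at p)" if "p \<in> D" for p
    by (rule differentiable_of_continuous_partials[OF D that u v smooth2_on_continuous[OF s(2)]])
  have c: "continuous_on D f"
    by (auto intro!: continuous_at_imp_continuous_on differentiable_imp_continuous_within d)
  have "Ck k D f" for k
  proof (cases k)
    case (Suc j)
    have j: "Ck j D fu" "Ck j D fv"
      using s by (simp_all add: smooth2_on_def)
    have "Ck (Suc j) D f"
    proof (rule Ck_SucI[OF c d])
      show "Ck j D (pu f)"
        by (rule Ck_cong[OF D _ j(1)]) (rule pu_eqI[OF u, symmetric])
      show "Ck j D (pv f)"
        by (rule Ck_cong[OF D _ j(2)]) (rule pv_eqI[OF v, symmetric])
    qed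
    then show ?thesis
      by (simp only: Suc)
  qed (simp add: c)
  then show ?thesis
    by (simp add: smooth2_on_def)
qed

text \<open>The primitive integrates \<open>P\<close> along the base line and then \<open>Q\<close>
  vertically. Differentiating the vertical integral in \<open>u\<close> gives the integral of
  \<open>pu Q = pv P\<close>, which is the change of \<open>P\<close> from the base line to the
  point.\<close>

lemma poincare_square:
  fixes P Q :: "real \<times> real \<Rightarrow> 'a::banach" and z0 :: 'a and u0 v0 r :: real
  defines "R \<equiv> {u0-r<..<u0+r} \<times> {v0-r<..<v0+r}"
  assumes D: "{u0-r..u0+r} \<times> {v0-r..v0+r} \<subseteq> D" "r > 0"
    and P: "smooth2_on D P" and Q: "smooth2_on D Q"
    and closed: "\<And>p. p \<in> D \<Longrightarrow> pv P p = pu Q p"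
  obtains z where "z (u0, v0) = z0" "smooth2_on R z" "\<And>p. p \<in> R \<Longrightarrow> pu z p = P p \<and> pv z p = Q p"
proof -
  define I where "I = {u0-r..u0+r}"
  define J where "J = {v0-r..v0+r}"
  have IJ: "I \<times> J \<subseteq> D" and u0: "u0 \<in> I" and v0: "v0 \<in> J"
    using D by (auto simp: I_def J_def)
  define z where "z p = z0 + prim u0 (\<lambda>s. P (s, v0)) (fst p) + prim v0 (\<lambda>t. Q (fst p, t)) (snd p)" for p
  have cP: "continuous_on (I \<times> J) P" and cQ: "continuous_on (I \<times> J) Q" and cQu: "continuous_on (I \<times> J) (pu Q)"
    using smooth2_on_continuous[OF P] smooth2_on_continuous[OF Q] smooth2_on_continuous[OF smooth2_on_pu[OF Q]]
      continuous_on_subset[OF _ IJ] by blast+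
  have slice_v: "continuous_on J (\<lambda>t. f (u, t))" if "continuous_on (I \<times> J) f" "u \<in> I"
    for f :: "real \<times> real \<Rightarrow> 'a" and u
    by (rule continuous_on_compose2[OF that(1)]) (use that in \<open>auto intro!: continuous_intros\<close>)
  have cP0: "continuous_on I (\<lambda>s. P (s, v0))"
    by (rule continuous_on_compose2[OF cP]) (use v0 in \<open>auto intro!: continuous_intros\<close>)
  have zv: "((\<lambda>t. z (u, t)) has_vector_derivative Q (u, v)) (at v within J)" if "u \<in> I" "v \<in> J" for u v
  proof -
    have "(prim v0 (\<lambda>t. Q (u, t)) has_vector_derivative Q (u, v)) (at v within J)"
      using slice_v[OF cQ that(1)] v0 that(2) unfolding J_def by (rule has_vector_derivative_prim)
    from has_vector_derivative_add[OF has_vector_derivative_const this] show ?thesis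
      by (simp add: z_def)
  qed
  have zu: "((\<lambda>t. z (t, v)) has_vector_derivative P (u, v)) (at u within I)" if u: "u \<in> I" and v: "v \<in> J" for u v
  proof -
    have 1: "(prim u0 (\<lambda>s. P (s, v0)) has_vector_derivative P (u, v0)) (at u within I)"
      using cP0 u0 u unfolding I_def by (rule has_vector_derivative_prim)
    have 2: "((\<lambda>u. prim v0 (\<lambda>t. Q (u, t)) v) has_vector_derivative prim v0 (\<lambda>t. pu Q (u, t)) v) (at u within I)"
    proof (rule prim_leibniz)
      fix u t assume ut: "u \<in> I" "t \<in> {v0-r..v0+r}"
      then have "(u, t) \<in> D"
        using IJ by (auto simp: J_def)
      from has_vector_derivative_pu[OF smooth2_on_differentiable[OF Q this]]
      show "((\<lambda>u. Q (u, t)) has_vector_derivative pu Q (u, t)) (at u within I)"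
        by (simp add: has_vector_derivative_at_within)
    next
      show "continuous_on {v0-r..v0+r} (\<lambda>t. Q (u, t))" if "u \<in> I" for u
        using slice_v[OF cQ that] by (simp add: J_def)
      show "continuous_on (I \<times> {v0-r..v0+r}) (\<lambda>(u, t). pu Q (u, t))"
        using cQu by (simp add: J_def)
    qed (use u v v0 in \<open>auto simp: I_def J_def\<close>)
    have "prim v0 (\<lambda>t. pu Q (u, t)) v = P (u, v) - P (u, v0)"
    proof (rule prim_eq_diff[of "v0-r" "v0+r"])
      fix t assume "t \<in> {v0-r..v0+r}"
      then have t: "(u, t) \<in> D"
        using IJ u by (auto simp: J_def)
      from has_vector_derivative_pv[OF smooth2_on_differentiable[OF P this]]
      show "((\<lambda>t. P (u, t)) has_vector_derivative pu Q (u, t)) (at t within {v0-r..v0+r})"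
        by (simp add: closed[OF t] has_vector_derivative_at_within)
    qed (use slice_v[OF cQu u] v v0 in \<open>auto simp: J_def\<close>)
    with has_vector_derivative_add[OF has_vector_derivative_add[OF has_vector_derivative_const 1] 2]
    show ?thesis
      by (simp add: z_def)
  qed
  have R: "open R"
    unfolding R_def by (intro open_Times open_greaterThanLessThan)
  have zu': "((\<lambda>t. z (t, snd p)) has_vector_derivative P p) (at (fst p))"
    and zv': "((\<lambda>t. z (fst p, t)) has_vector_derivative Q p) (at (snd p))" if "p \<in> R" for p
  proof -
    have m: "fst p \<in> I" "snd p \<in> J" "u0 - r < fst p" "fst p < u0 + r" "v0 - r < snd p" "snd p < v0 + r"
      using that by (auto simp: R_def I_def J_def)
    show "((\<lambda>t. z (t, snd p)) has_vector_derivative P p) (at (fst p))"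
      using zu[OF m(1,2)] m(3,4) by (simp add: I_def at_within_Icc_at)
    show "((\<lambda>t. z (fst p, t)) has_vector_derivative Q p) (at (snd p))"
      using zv[OF m(1,2)] m(5,6) by (simp add: J_def at_within_Icc_at)
  qed
  have RD: "R \<subseteq> D"
    using IJ by (auto simp: R_def I_def J_def)
  show thesis
  proof (rule that[of z])
    show "smooth2_on R z"
      by (rule smooth2_on_partialsI[OF R zu' zv' smooth2_on_subset[OF P RD] smooth2_on_subset[OF Q RD]])
    show "pu z p = P p \<and> pv z p = Q p" if "p \<in> R" for p
      using pu_eqI[OF zu'[OF that]] pv_eqI[OF zv'[OF that]] by simp
  qed (simp add: z_def)
qed

section \<open>The surface at a point\<close>

lemma mink_commute: "mink a b = mink b a"
  by (simp add: mink_def mult.commute)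

lemma mink_linear [simp]:
  "mink (a + b) c = mink a c + mink b c" "mink c (a + b) = mink c a + mink c b"
  "mink (a - b) c = mink a c - mink b c" "mink c (a - b) = mink c a - mink c b"
  "mink (- a) c = - mink a c" "mink c (- a) = - mink c a"
  "mink (s *\<^sub>R a) c = s * mink a c" "mink c (s *\<^sub>R a) = s * mink c a"
  "mink 0 c = 0" "mink c 0 = 0"
  by (simp_all add: mink_def algebra_simps)

lemma vector_4:
  "(vector [a, b, c, d] :: 'a::zero^4) $ 1 = a" "(vector [a, b, c, d] :: 'a::zero^4) $ 2 = b"
  "(vector [a, b, c, d] :: 'a::zero^4) $ 3 = c" "(vector [a, b, c, d] :: 'a::zero^4) $ 4 = d"
  unfolding vector_def by simp_all

text \<open>Flipping the sign of the last coordinate of \<open>w\<close> turns \<open>mink\<close>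
  into the Euclidean product, so the flipped vector lies in the kernel of the invertible matrix with
  rows \<open>a, b, c, d\<close>.\<close>

lemma mink_nondegenerate:
  assumes "det (vector [a, b, c, d] :: real^4^4) \<noteq> 0"
    and "mink w a = 0" "mink w b = 0" "mink w c = 0" "mink w d = 0"
  shows "w = 0"
proof -
  let ?M = "vector [a, b, c, d] :: real^4^4"
  let ?w = "vector [w $ 1, w $ 2, w $ 3, - (w $ 4)] :: real^4"
  have "?M *v ?w = 0"
    using assms(2-5)
    by (simp add: vec_eq_iff forall_4 matrix_vector_mult_def sum_4 vector_4 mink_def mult.commute)
  moreover have "\<exists>B. B ** ?M = mat 1"
    using assms(1) by (simp add: invertible_det_nz[symmetric] invertible_left_inverse)
  ultimately have "?w = 0"
    unfolding matrix_left_invertible_ker by blast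
  then show ?thesis
    by (simp add: vec_eq_iff forall_4 vector_4)
qed

text \<open>All extrinsic data at one point follow from these second derivatives by algebra.
  \<open>a\<close> and \<open>b\<close> stand for the square roots of E and G; \<open>t1\<close>,
  \<open>t2\<close>, \<open>t3\<close> will be derivatives of these roots and contribute only
  tangential terms.\<close>

locale trapped_frame_at =
  fixes z :: surf and p :: "real \<times> real" and a b t1 t2 t3 g1 g2 nu la mu :: real
    and x y n m :: "real^4"
  assumes pos: "a > 0" "b > 0" and mu: "mu \<noteq> 0"
    and zu: "pu z p = a *\<^sub>R x" and zv: "pv z p = b *\<^sub>R y"
    and zuu: "pu (pu z) p = t1 *\<^sub>R x + a\<^sup>2 *\<^sub>R (g1 *\<^sub>R y + (1 + nu) *\<^sub>R n)"
    and zuv: "pv (pu z) p = t2 *\<^sub>R x + (a * b) *\<^sub>R (- g2 *\<^sub>R y + la *\<^sub>R n + mu *\<^sub>R m)"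
    and zvv: "pv (pv z) p = t3 *\<^sub>R y + b\<^sup>2 *\<^sub>R (g2 *\<^sub>R x + (1 - nu) *\<^sub>R n)"
    and gram: "mink x x = 1" "mink y y = 1" "mink x y = 0" "mink n x = 0" "mink n y = 0"
      "mink m x = 0" "mink m y = 0" "mink n n = 0" "mink m m = 0" "mink n m = -1"
begin

lemma gram': "mink y x = 0" "mink x n = 0" "mink y n = 0" "mink x m = 0" "mink y m = 0" "mink m n = -1"
  using gram by (simp_all add: mink_commute)

lemma first_form: "fE z p = a\<^sup>2" "fF z p = 0" "fG z p = b\<^sup>2"
  by (simp_all add: fE_def fF_def fG_def zu zv gram power2_eq_square)

lemma tc: "tc1 z p w = mink w x / a" "tc2 z p w = mink w y / b"
  using pos by (simp_all add: tc1_def tc2_def first_form zu zv power2_eq_square)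

lemma tang_part: "tang_part z p w = mink w x *\<^sub>R x + mink w y *\<^sub>R y"
  using pos by (simp add: tang_part_def tc zu zv)

lemma second_form:
  "s11 z p = (a\<^sup>2 * (1 + nu)) *\<^sub>R n"
  "s12 z p = (a * b) *\<^sub>R (la *\<^sub>R n + mu *\<^sub>R m)"
  "s22 z p = (b\<^sup>2 * (1 - nu)) *\<^sub>R n"
  by (simp_all add: s11_def s12_def s22_def nor_part_def tang_part zuu zuv zvv gram gram'
      scaleR_add_right scaleR_diff_right)

lemma meanH: "meanH z p = n"
proof -
  have "meanH z p = (1 / (2 * (a\<^sup>2 * b\<^sup>2))) *\<^sub>R ((b\<^sup>2 * (a\<^sup>2 * (1 + nu)) + a\<^sup>2 * (b\<^sup>2 * (1 - nu))) *\<^sub>R n)"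
    by (simp add: meanH_def first_form second_form scaleR_add_left)
  also have "b\<^sup>2 * (a\<^sup>2 * (1 + nu)) + a\<^sup>2 * (b\<^sup>2 * (1 - nu)) = 2 * (a\<^sup>2 * b\<^sup>2)"
    by (simp add: algebra_simps)
  finally show ?thesis
    using pos by simp
qed

lemma sff: "sff z p x x = (1 + nu) *\<^sub>R n" "sff z p y y = (1 - nu) *\<^sub>R n"
  using pos by (simp_all add: sff_def tc gram gram' second_form power2_eq_square)

lemma normal_nonzero: "n \<noteq> 0"
  using gram(10) by auto

lemma not_flat: "\<not> flat_point z p"
proof
  assume "flat_point z p"
  then obtain e3 e4 where e: "is_normal z p e3" "is_normal z p e4"
    and det: "det (vector [pu z p, pv z p, e3, e4] :: real^4^4) > 0"
    and L: "mink (pu (pu z) p) e3 * mink (pv (pu z) p) e4 - mink (pv (pu z) p) e3 * mink (pu (pu z) p) e4 = 0"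
    and N: "mink (pv (pu z) p) e3 * mink (pv (pv z) p) e4 - mink (pv (pv z) p) e3 * mink (pv (pu z) p) e4 = 0"
    using pos by (auto simp: flat_point_def Let_def first_form real_sqrt_mult)
  have xy: "mink x e3 = 0" "mink y e3 = 0" "mink x e4 = 0" "mink y e4 = 0"
    using e pos by (auto simp: is_normal_def zu zv mink_commute)
  \<comment> \<open>The determinant pairing the null basis \<open>n, m\<close> with
    \<open>e3, e4\<close>. \<open>L\<close> and \<open>N\<close> are multiples of \<open>?d\<close>
    by \<open>1 + nu\<close> and \<open>1 - nu\<close>, with nonzero factors containing
    \<open>mu\<close>.\<close>
  let ?d = "mink n e3 * mink m e4 - mink m e3 * mink n e4"
  have "a\<^sup>2 * (1 + nu) * (a * b * mu) * ?d = 0"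
    using L by (simp add: zuu zuv xy algebra_simps)
  moreover have "b\<^sup>2 * (1 - nu) * (a * b * mu) * ?d = 0"
    using N by (simp add: zvv zuv xy algebra_simps)
  ultimately have "(1 + nu) * ?d = 0" "(1 - nu) * ?d = 0"
    using pos mu by auto
  then have d: "?d = 0"
    by (auto simp: mult_eq_0_iff)
  \<comment> \<open>A combination of \<open>n\<close> and \<open>m\<close> is orthogonal to both
    tangent vectors already; orthogonality to \<open>e3\<close> and \<open>e4\<close> makes it
    orthogonal to a whole basis.\<close>
  have zero: "w = 0" if "w = s *\<^sub>R n + t *\<^sub>R m" "mink w e3 = 0" "mink w e4 = 0" for w s t
  proof (rule mink_nondegenerate)
    show "det (vector [pu z p, pv z p, e3, e4] :: real^4^4) \<noteq> 0"
      using det by simp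
  qed (use that gram in \<open>simp_all add: zu zv\<close>)
  have coeff: "s = 0 \<and> t = 0" if "s *\<^sub>R n + t *\<^sub>R m = 0" for s t
    using arg_cong[OF that, of "mink n"] arg_cong[OF that, of "mink m"] gram gram' by simp
  \<comment> \<open>This combination is orthogonal to \<open>e3\<close> by construction and to
    \<open>e4\<close> because \<open>?d = 0\<close>. It therefore vanishes, and so do its
    coefficients; the same trick with \<open>e4\<close> leaves \<open>n\<close> orthogonal to
    everything.\<close>
  have c3: "mink m e3 = 0" "mink n e3 = 0"
    using coeff[OF zero[of _ "mink m e3" "- mink n e3", OF refl]] d by (auto simp: algebra_simps)
  have c4: "mink n e4 = 0"
    using coeff[OF zero[of _ "mink m e4" "- mink n e4", OF refl]] d by (auto simp: algebra_simps)
  have "n = 0"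
    by (rule zero[of _ 1 0]) (use c3 c4 in simp_all)
  then show False
    using normal_nonzero by simp
qed

end

section \<open>The coefficient matrices\<close>

text \<open>The frame \<open>x, y, n\<^sub>1, n\<^sub>2\<close> is stored as the rows of a matrix \<open>F\<close>; with
  \<open>s = \<surd>E\<close> and \<open>s = \<surd>G\<close> respectively, the derivative formulas read
  \<open>F\<^sub>u = coeff_u F\<close> and \<open>F\<^sub>v = coeff_v F\<close>.\<close>

definition coeff_u :: "real \<Rightarrow> real \<Rightarrow> real \<Rightarrow> real \<Rightarrow> real \<Rightarrow> real \<Rightarrow> real^4^4" where
  "coeff_u s g nu la mu b = vector
    [vector [0, s * g, s * (1 + nu), 0],
     vector [- (s * g), 0, s * la, s * mu],
     vector [0, s * mu, s * b, 0],
     vector [s * (1 + nu), s * la, 0, - (s * b)]]"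

definition coeff_v :: "real \<Rightarrow> real \<Rightarrow> real \<Rightarrow> real \<Rightarrow> real \<Rightarrow> real \<Rightarrow> real^4^4" where
  "coeff_v s g nu la mu b = vector
    [vector [0, - (s * g), s * la, s * mu],
     vector [s * g, 0, s * (1 - nu), 0],
     vector [s * mu, 0, s * b, 0],
     vector [s * la, s * (1 - nu), 0, - (s * b)]]"

definition lorentz_form :: "real^4^4" where
  "lorentz_form = vector [vector [1,0,0,0], vector [0,1,0,0], vector [0,0,1,0], vector [0,0,0,-1]]"

text \<open>The Gram matrix prescribed for \<open>x, y, n1, n2\<close>: an orthonormal tangent pair
  and a lightlike normal pair with product -1.\<close>

definition frame_gram :: "real^4^4" where
  "frame_gram = vector [vector [1,0,0,0], vector [0,1,0,0], vector [0,0,0,-1], vector [0,0,-1,0]]"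

text \<open>The coefficients lie in the Lie algebra of the group preserving
  \<open>frame_gram\<close>, whatever the values of the geometric functions.\<close>

lemma coeff_skew:
  "coeff_u s g nu la mu b ** frame_gram + frame_gram ** transpose (coeff_u s g nu la mu b) = 0"
  "coeff_v s g nu la mu b ** frame_gram + frame_gram ** transpose (coeff_v s g nu la mu b) = 0"
  by (simp_all add: vec_eq_iff forall_4 matrix_matrix_mult_def sum_4 transpose_def
      coeff_u_def coeff_v_def frame_gram_def vector_4)

lemma lorentz_form_gram:
  "(F ** lorentz_form ** transpose F) $ i $ j = mink (F $ i) (F $ j)"
  by (simp add: matrix_matrix_mult_def sum_4 transpose_def lorentz_form_def vector_4 mink_def)

lemma matrix_mul_row_4:
  fixes A :: "real^4^'n" and F :: "real^'m^4"
  shows "(A ** F) $ i = A $ i $ 1 *\<^sub>R F $ 1 + A $ i $ 2 *\<^sub>R F $ 2 + A $ i $ 3 *\<^sub>R F $ 3 + A $ i $ 4 *\<^sub>R F $ 4"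
  by (simp add: vec_eq_iff matrix_matrix_mult_def sum_4)

lemma smooth2_on_vector_4:
  fixes a b c d :: "real \<times> real \<Rightarrow> 'a::real_normed_vector"
  assumes "open D" "smooth2_on D a" "smooth2_on D b" "smooth2_on D c" "smooth2_on D d"
  shows "smooth2_on D (\<lambda>q. vector [a q, b q, c q, d q] :: 'a^4)"
proof -
  have "smooth2_on D (\<lambda>q. (vector [a q, b q, c q, d q] :: 'a^4) $ i)" for i
    using exhaust_4[of i] assms(2-5) by (auto simp: vector_4)
  then have "smooth2_on D (\<lambda>q. \<chi> i. (vector [a q, b q, c q, d q] :: 'a^4) $ i)"
    by (rule smooth2_on_vec_lambda[OF assms(1)])
  then show ?thesis
    by simp
qed

lemma pu_vec_nth: "f differentiable (at p) \<Longrightarrow> pu f p $ i = pu (\<lambda>q. f q $ i) p"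
  by (simp add: pu_linear[OF bounded_linear_vec_nth])

lemma pv_vec_nth: "f differentiable (at p) \<Longrightarrow> pv f p $ i = pv (\<lambda>q. f q $ i) p"
  by (simp add: pv_linear[OF bounded_linear_vec_nth])

lemma smooth2_on_coeff_u:
  assumes "open D" "smooth2_on D s" "smooth2_on D g" "smooth2_on D nu" "smooth2_on D la"
    "smooth2_on D mu" "smooth2_on D b"
  shows "smooth2_on D (\<lambda>q. coeff_u (s q) (g q) (nu q) (la q) (mu q) (b q))"
  unfolding coeff_u_def
  by (intro smooth2_on_vector_4 smooth2_on_mult smooth2_on_minus smooth2_on_add smooth2_on_const assms)

lemma smooth2_on_coeff_v:
  assumes "open D" "smooth2_on D s" "smooth2_on D g" "smooth2_on D nu" "smooth2_on D la"
    "smooth2_on D mu" "smooth2_on D b"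
  shows "smooth2_on D (\<lambda>q. coeff_v (s q) (g q) (nu q) (la q) (mu q) (b q))"
  unfolding coeff_v_def
  by (intro smooth2_on_vector_4 smooth2_on_mult smooth2_on_minus smooth2_on_diff smooth2_on_const assms)

lemma pu_mult:
  fixes f g :: "real \<times> real \<Rightarrow> real"
  shows "f differentiable (at p) \<Longrightarrow> g differentiable (at p) \<Longrightarrow> pu (\<lambda>q. f q * g q) p = f p * pu g p + pu f p * g p"
  by (rule pu_bilinear[OF bounded_bilinear_mult])

lemma pv_mult:
  fixes f g :: "real \<times> real \<Rightarrow> real"
  shows "f differentiable (at p) \<Longrightarrow> g differentiable (at p) \<Longrightarrow> pv (\<lambda>q. f q * g q) p = f p * pv g p + pv f p * g p"
  by (rule pv_bilinear[OF bounded_bilinear_mult])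

lemma pu_minus: "f differentiable (at p) \<Longrightarrow> pu (\<lambda>q. - f q) p = - pu f p"
  by (rule pu_linear[OF bounded_linear_minus[OF bounded_linear_ident]])

lemma pv_minus: "f differentiable (at p) \<Longrightarrow> pv (\<lambda>q. - f q) p = - pv f p"
  by (rule pv_linear[OF bounded_linear_minus[OF bounded_linear_ident]])

text \<open>Entry by entry, with denominators cleared: (1,2) is the Gauss equation
  \<open>eq3\<close>, (1,3) and (2,3) are the Codazzi equations \<open>eq4\<close> and
  \<open>eq5\<close>, (1,4) and (2,4) are the equations for \<open>pu mu\<close> and
  \<open>pv mu\<close>, and (3,3) is the Ricci equation \<open>eq6\<close>. \<open>E\<close> and
  \<open>G\<close> eliminate the derivatives of the metric factors.\<close>

lemma coeff_compat:
  fixes sE sG g1 g2 nu la mu b1 b2 :: "real \<times> real \<Rightarrow> real"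
  defines "A \<equiv> \<lambda>q. coeff_u (sE q) (g1 q) (nu q) (la q) (mu q) (b1 q)"
    and "B \<equiv> \<lambda>q. coeff_v (sG q) (g2 q) (nu q) (la q) (mu q) (b2 q)"
  assumes D: "open D" "p \<in> D"
    and sm: "smooth2_on D sE" "smooth2_on D sG" "smooth2_on D g1" "smooth2_on D g2" "smooth2_on D nu"
      "smooth2_on D la" "smooth2_on D mu" "smooth2_on D b1" "smooth2_on D b2"
    and E: "pv sE p = - g1 p * sE p * sG p" and G: "pu sG p = - g2 p * sE p * sG p"
    and mu: "pu mu p = sE p * mu p * (2 * g2 p + b1 p)" "pv mu p = sG p * mu p * (2 * g1 p + b2 p)"
    and eq3: "sG p * pu g2 p + sE p * pv g1 p = sE p * sG p * (2 * la p * mu p + (g1 p)\<^sup>2 + (g2 p)\<^sup>2)"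
    and eq4: "sG p * pu la p - sE p * pv nu p
       = sE p * sG p * (2 * la p * g2 p - 2 * nu p * g1 p - la p * b1 p + (1 + nu p) * b2 p)"
    and eq5: "sG p * pu nu p + sE p * pv la p
       = sE p * sG p * (2 * la p * g1 p + 2 * nu p * g2 p + (1 - nu p) * b1 p - la p * b2 p)"
    and eq6: "sE p * pv b1 p - sG p * pu b2 p
       = sE p * sG p * (g1 p * b1 p - g2 p * b2 p + 2 * nu p * mu p)"
  shows "pv A p + A p ** B p = pu B p + B p ** A p"
proof -
  note df = sm[THEN smooth2_on_differentiable, OF D(2)]
  have dA: "A differentiable (at p)" "(\<lambda>q. A q $ i) differentiable (at p)"
    and dB: "B differentiable (at p)" "(\<lambda>q. B q $ i) differentiable (at p)" for i
    unfolding A_def B_def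
    by (intro smooth2_on_differentiable[OF _ D(2)] smooth2_on_vec_nth smooth2_on_coeff_u smooth2_on_coeff_v D sm)+
  have A: "pv A p $ i $ j = pv (\<lambda>q. A q $ i $ j) p" and B: "pu B p $ i $ j = pu (\<lambda>q. B q $ i $ j) p" for i j
    using dA dB by (simp_all add: pu_vec_nth pv_vec_nth)
  note d = pu_mult pv_mult pu_minus pv_minus pu_add pv_add pu_diff pv_diff df differentiable_mult
    differentiable_minus differentiable_add differentiable_diff
  show ?thesis
    unfolding vec_eq_iff forall_4 vector_add_component A B
    by (simp add: A_def B_def coeff_u_def coeff_v_def vector_4 d matrix_matrix_mult_def sum_4 E G mu,
        insert eq3 eq4 eq5 eq6, intro conjI; (simp only: algebra_simps power2_eq_square)?; linarith)
qed

text \<open>The rows are the derivative formulas multiplied by \<open>s\<close>. They serve in both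
  directions: to read the formulas off the constructed frame, and to turn the formulas of a
  competing surface into the matrix system.\<close>

lemma coeff_mul_frame:
  fixes F :: "real^'m^4"
  shows "(coeff_u s g nu la mu b ** F) $ 1 = s *\<^sub>R (g *\<^sub>R F $ 2 + (1 + nu) *\<^sub>R F $ 3)"
    "(coeff_u s g nu la mu b ** F) $ 2 = s *\<^sub>R (- g *\<^sub>R F $ 1 + la *\<^sub>R F $ 3 + mu *\<^sub>R F $ 4)"
    "(coeff_u s g nu la mu b ** F) $ 3 = s *\<^sub>R (mu *\<^sub>R F $ 2 + b *\<^sub>R F $ 3)"
    "(coeff_u s g nu la mu b ** F) $ 4 = s *\<^sub>R ((1 + nu) *\<^sub>R F $ 1 + la *\<^sub>R F $ 2 - b *\<^sub>R F $ 4)"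
    "(coeff_v s g nu la mu b ** F) $ 1 = s *\<^sub>R (- g *\<^sub>R F $ 2 + la *\<^sub>R F $ 3 + mu *\<^sub>R F $ 4)"
    "(coeff_v s g nu la mu b ** F) $ 2 = s *\<^sub>R (g *\<^sub>R F $ 1 + (1 - nu) *\<^sub>R F $ 3)"
    "(coeff_v s g nu la mu b ** F) $ 3 = s *\<^sub>R (mu *\<^sub>R F $ 1 + b *\<^sub>R F $ 3)"
    "(coeff_v s g nu la mu b ** F) $ 4 = s *\<^sub>R (la *\<^sub>R F $ 1 + (1 - nu) *\<^sub>R F $ 2 - b *\<^sub>R F $ 4)"
  by (simp_all add: matrix_mul_row_4 coeff_u_def coeff_v_def vector_4 scaleR_add_right scaleR_diff_right)

lemma pu_scaleR:
  "f differentiable (at p) \<Longrightarrow> g differentiable (at p) \<Longrightarrow> pu (\<lambda>q. f q *\<^sub>R g q) p = f p *\<^sub>R pu g p + pu f p *\<^sub>R g p"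
  by (rule pu_bilinear[OF bounded_bilinear_scaleR])

lemma pv_scaleR:
  "f differentiable (at p) \<Longrightarrow> g differentiable (at p) \<Longrightarrow> pv (\<lambda>q. f q *\<^sub>R g q) p = f p *\<^sub>R pv g p + pv f p *\<^sub>R g p"
  by (rule pv_bilinear[OF bounded_bilinear_scaleR])

section \<open>Integration of the frame and the surface, and comparison with competing
  surfaces\<close>

theorem theorem4p1:
  fixes D :: "(real \<times> real) set"
    and g1 g2 nu la mu b1 b2 :: "real \<times> real \<Rightarrow> real"
    and u0 v0 :: real and p0 x0 y0 n10 n20 :: "real^4"
  defines "sE \<equiv> (\<lambda>p. pu mu p / (mu p * (2 * g2 p + b1 p)))"
      and "sG \<equiv> (\<lambda>p. pv mu p / (mu p * (2 * g1 p + b2 p)))"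
  assumes dom: "domain2 D"
    and sm: "smooth2_on D g1" "smooth2_on D g2" "smooth2_on D nu" "smooth2_on D la"
            "smooth2_on D mu" "smooth2_on D b1" "smooth2_on D b2"
    and pos: "\<forall>p\<in>D. sE p > 0 \<and> sG p > 0"
    and eq1: "\<forall>p\<in>D. - g1 p * sE p * sG p = pv sE p"
    and eq2: "\<forall>p\<in>D. - g2 p * sE p * sG p = pu sG p"
    and eq3: "\<forall>p\<in>D. 2 * la p * mu p = pu g2 p / sE p + pv g1 p / sG p - ((g1 p)\<^sup>2 + (g2 p)\<^sup>2)"
    and eq4: "\<forall>p\<in>D. 2 * la p * g2 p - 2 * nu p * g1 p - la p * b1 p + (1 + nu p) * b2 p
                    = pu la p / sE p - pv nu p / sG p"
    and eq5: "\<forall>p\<in>D. 2 * la p * g1 p + 2 * nu p * g2 p + (1 - nu p) * b1 p - la p * b2 p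
                    = pu nu p / sE p + pv la p / sG p"
    and eq6: "\<forall>p\<in>D. g1 p * b1 p - g2 p * b2 p + 2 * nu p * mu p
                    = - pu b2 p / sE p + pv b1 p / sG p"
    and pt: "(u0, v0) \<in> D"
    and fr: "mink x0 x0 = 1" "mink y0 y0 = 1" "mink x0 y0 = 0"
            "mink n10 n10 = 0" "mink n20 n20 = 0" "mink n10 n20 = -1"
            "mink n10 x0 = 0" "mink n10 y0 = 0" "mink n20 x0 = 0" "mink n20 y0 = 0"
  shows "\<exists>D0. domain2 D0 \<and> D0 \<subseteq> D \<and> (u0, v0) \<in> D0 \<and>
     (let P = (\<lambda>z::real \<times> real \<Rightarrow> real^4.
        let x = (\<lambda>p. (1 / sE p) *\<^sub>R pu z p);
            y = (\<lambda>p. (1 / sG p) *\<^sub>R pv z p);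
            dx = (\<lambda>X p. (1 / sE p) *\<^sub>R pu X p);
            dy = (\<lambda>X p. (1 / sG p) *\<^sub>R pv X p)
        in marginally_trapped_on D0 z \<and>
           (\<forall>p\<in>D0. \<not> flat_point z p) \<and>
           z (u0, v0) = p0 \<and>
           (\<forall>p\<in>D0. fE z p = (sE p)\<^sup>2 \<and> fG z p = (sG p)\<^sup>2 \<and> fF z p = 0) \<and>
           (\<exists>n1 n2. smooth2_on D0 n1 \<and> smooth2_on D0 n2 \<and>
              geometric_frame_on D0 z x y n1 n2 \<and>
              x (u0, v0) = x0 \<and> y (u0, v0) = y0 \<and> n1 (u0, v0) = n10 \<and> n2 (u0, v0) = n20 \<and>
              (\<forall>p\<in>D0.
                 dx x p = g1 p *\<^sub>R y p + (1 + nu p) *\<^sub>R n1 p \<and>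
                 dx y p = - g1 p *\<^sub>R x p + la p *\<^sub>R n1 p + mu p *\<^sub>R n2 p \<and>
                 dy x p = - g2 p *\<^sub>R y p + la p *\<^sub>R n1 p + mu p *\<^sub>R n2 p \<and>
                 dy y p = g2 p *\<^sub>R x p + (1 - nu p) *\<^sub>R n1 p \<and>
                 dx n1 p = mu p *\<^sub>R y p + b1 p *\<^sub>R n1 p \<and>
                 dy n1 p = mu p *\<^sub>R x p + b2 p *\<^sub>R n1 p \<and>
                 dx n2 p = (1 + nu p) *\<^sub>R x p + la p *\<^sub>R y p - b1 p *\<^sub>R n2 p \<and>
                 dy n2 p = la p *\<^sub>R x p + (1 - nu p) *\<^sub>R y p - b2 p *\<^sub>R n2 p)))
      in \<exists>z. P z \<and> (\<forall>z'. P z' \<longrightarrow> (\<forall>p\<in>D0. z' p = z p)))"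
proof -
  have D: "open D"
    using dom by (simp add: domain2_def)
  \<comment> \<open>Division by zero yields 0, so positivity of the quotients already excludes
    vanishing denominators.\<close>
  have den: "mu p * (2 * g2 p + b1 p) \<noteq> 0" "mu p * (2 * g1 p + b2 p) \<noteq> 0" if "p \<in> D" for p
    using pos that by (auto simp: sE_def sG_def)
  have sEG: "sE p > 0" "sG p > 0" and mu0: "mu p \<noteq> 0" if "p \<in> D" for p
    using pos that den(1)[OF that] by auto
  have muD: "pu mu p = sE p * mu p * (2 * g2 p + b1 p)" "pv mu p = sG p * mu p * (2 * g1 p + b2 p)"
    if "p \<in> D" for p
    using den[OF that] by (simp_all add: sE_def sG_def)
  have smE: "smooth2_on D sE" and smG: "smooth2_on D sG"
    unfolding sE_def sG_def
    by (intro smooth2_on_divide smooth2_on_pu smooth2_on_pv smooth2_on_mult smooth2_on_add smooth2_on_const D sm;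
        use den in simp)+
  define A where "A = (\<lambda>q. coeff_u (sE q) (g1 q) (nu q) (la q) (mu q) (b1 q))"
  define B where "B = (\<lambda>q. coeff_v (sG q) (g2 q) (nu q) (la q) (mu q) (b2 q))"
  have smA: "smooth2_on D A" and smB: "smooth2_on D B"
    unfolding A_def B_def by (intro smooth2_on_coeff_u smooth2_on_coeff_v D smE smG sm)+
  have compat: "pv A p + A p ** B p = pu B p + B p ** A p" if p: "p \<in> D" for p
    unfolding A_def B_def
  proof (rule coeff_compat[OF D p smE smG sm _ _ muD[OF p]])
    note e = sEG[OF p]
    show "pv sE p = - g1 p * sE p * sG p" "pu sG p = - g2 p * sE p * sG p"
      using eq1 eq2 p by auto
    show "sG p * pu g2 p + sE p * pv g1 p = sE p * sG p * (2 * la p * mu p + (g1 p)\<^sup>2 + (g2 p)\<^sup>2)"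
      using bspec[OF eq3 p] e by (simp add: field_simps)
    show "sG p * pu la p - sE p * pv nu p
       = sE p * sG p * (2 * la p * g2 p - 2 * nu p * g1 p - la p * b1 p + (1 + nu p) * b2 p)"
      using e by (simp add: bspec[OF eq4 p] right_diff_distrib)
    show "sG p * pu nu p + sE p * pv la p
       = sE p * sG p * (2 * la p * g1 p + 2 * nu p * g2 p + (1 - nu p) * b1 p - la p * b2 p)"
      using e by (simp add: bspec[OF eq5 p] distrib_left)
    show "sE p * pv b1 p - sG p * pu b2 p = sE p * sG p * (g1 p * b1 p - g2 p * b2 p + 2 * nu p * mu p)"
      unfolding bspec[OF eq6 p] using e by (simp add: field_simps)
  qed
  define W :: "real^4^4" where "W = vector [x0, y0, n10, n20]"
  obtain F r where r: "r > 0" "{u0-r..u0+r} \<times> {v0-r..v0+r} \<subseteq> D"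
    and F0: "F (u0, v0) = W" and smF: "smooth2_on ({u0-r<..<u0+r} \<times> {v0-r<..<v0+r}) F"
    and dF: "\<And>p. p \<in> {u0-r<..<u0+r} \<times> {v0-r<..<v0+r} \<Longrightarrow> pu F p = A p ** F p \<and> pv F p = B p ** F p"
    using linear_frobenius[OF D pt smA smB compat, of W] by blast
  define R where "R = {u0-r<..<u0+r} \<times> {v0-r<..<v0+r}"
  \<comment> \<open>Half the size puts the closed square inside the open set \<open>R\<close> on
    which \<open>F\<close> is smooth, as the construction of the primitive requires.\<close>
  define h where "h = r / 2"
  define D0 where "D0 = {u0-h<..<u0+h} \<times> {v0-h<..<v0+h}"
  have h: "h > 0" "h < r"
    using r(1) by (auto simp: h_def)
  have hR: "{u0-h..u0+h} \<times> {v0-h..v0+h} \<subseteq> R"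
    using h by (auto simp: R_def)
  have hD: "{u0-h..u0+h} \<times> {v0-h..v0+h} \<subseteq> D"
    using h r(2) by auto
  have D0R: "D0 \<subseteq> R"
    using h by (auto simp: R_def D0_def)
  have RD: "R \<subseteq> D"
    using r(2) by (auto simp: R_def)
  have oR: "open R" and oD0: "open D0"
    unfolding R_def D0_def by (intro open_Times open_greaterThanLessThan)+
  have p0R: "(u0, v0) \<in> R" and p0D0: "(u0, v0) \<in> D0"
    using r(1) h(1) by (auto simp: R_def D0_def)
  have con: "continuous_on D A" "continuous_on D B"
    using smA smB by (auto intro: smooth2_on_continuous)
  note smF = smF[folded R_def] and dF = dF[folded R_def]
  have diffF: "F differentiable (at p)" if "p \<in> R" for p
    by (rule smooth2_on_differentiable[OF smF that])
  have Gram: "F p ** lorentz_form ** transpose (F p) = frame_gram" if "p \<in> R" for p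
  proof (rule linear_system_gram[of "u0-r" "u0+r" "v0-r" "v0+r" A B])
    have "(W ** lorentz_form ** transpose W) $ i $ j = frame_gram $ i $ j" for i j
      unfolding lorentz_form_gram using exhaust_4[of i] exhaust_4[of j] fr
      by (auto simp: W_def frame_gram_def vector_4 mink_commute[of y0 x0] mink_commute[of n20 n10]
          mink_commute[of x0 n10] mink_commute[of x0 n20] mink_commute[of y0 n10] mink_commute[of y0 n20])
    then show "F (u0, v0) ** lorentz_form ** transpose (F (u0, v0)) = frame_gram"
      by (simp add: F0 vec_eq_iff)
    show "A q ** frame_gram + frame_gram ** transpose (A q) = 0"
      "B q ** frame_gram + frame_gram ** transpose (B q) = 0" for q
      by (simp_all add: A_def B_def coeff_skew)
  qed (use con r(2) dF diffF p0R that in \<open>auto simp: R_def[symmetric] intro: continuous_on_subset\<close>)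
  define X where "X p = F p $ 1" for p
  define Y where "Y p = F p $ 2" for p
  define N where "N p = F p $ 3" for p
  define M where "M p = F p $ 4" for p
  note XYNM = X_def Y_def N_def M_def
  have gram: "mink (X p) (X p) = 1" "mink (Y p) (Y p) = 1" "mink (X p) (Y p) = 0" "mink (N p) (X p) = 0"
    "mink (N p) (Y p) = 0" "mink (M p) (X p) = 0" "mink (M p) (Y p) = 0" "mink (N p) (N p) = 0"
    "mink (M p) (M p) = 0" "mink (N p) (M p) = -1" if "p \<in> R" for p
    unfolding XYNM lorentz_form_gram[symmetric] Gram[OF that]
    by (simp_all add: frame_gram_def vector_4)
  have smR: "smooth2_on R X" "smooth2_on R Y" "smooth2_on R N" "smooth2_on R M"
    unfolding XYNM by (intro smooth2_on_vec_nth oR smF)+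
  have smER: "smooth2_on R sE" "smooth2_on R sG"
    using smE smG RD by (auto intro: smooth2_on_subset)
  note diffR = smooth2_on_differentiable[OF smR(1)] smooth2_on_differentiable[OF smR(2)]
    smooth2_on_differentiable[OF smER(1)] smooth2_on_differentiable[OF smER(2)]
  have der: "pu X p = sE p *\<^sub>R (g1 p *\<^sub>R Y p + (1 + nu p) *\<^sub>R N p)"
    "pu Y p = sE p *\<^sub>R (- g1 p *\<^sub>R X p + la p *\<^sub>R N p + mu p *\<^sub>R M p)"
    "pu N p = sE p *\<^sub>R (mu p *\<^sub>R Y p + b1 p *\<^sub>R N p)"
    "pu M p = sE p *\<^sub>R ((1 + nu p) *\<^sub>R X p + la p *\<^sub>R Y p - b1 p *\<^sub>R M p)"
    "pv X p = sG p *\<^sub>R (- g2 p *\<^sub>R Y p + la p *\<^sub>R N p + mu p *\<^sub>R M p)"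
    "pv Y p = sG p *\<^sub>R (g2 p *\<^sub>R X p + (1 - nu p) *\<^sub>R N p)"
    "pv N p = sG p *\<^sub>R (mu p *\<^sub>R X p + b2 p *\<^sub>R N p)"
    "pv M p = sG p *\<^sub>R (la p *\<^sub>R X p + (1 - nu p) *\<^sub>R Y p - b2 p *\<^sub>R M p)"
    if "p \<in> R" for p
    unfolding XYNM pu_vec_nth[OF diffF[OF that], symmetric] pv_vec_nth[OF diffF[OF that], symmetric]
    using dF[OF that] by (simp_all add: A_def B_def coeff_mul_frame)
  \<comment> \<open>The normal parts agree because \<open>pv X / sG\<close> and
    \<open>pu Y / sE\<close> have the same \<open>N\<close> and \<open>M\<close> terms;
    \<open>eq1\<close> matches the \<open>X\<close> components and \<open>eq2\<close> the
    \<open>Y\<close> components.\<close>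
  have closed: "pv (\<lambda>p. sE p *\<^sub>R X p) p = pu (\<lambda>p. sG p *\<^sub>R Y p) p" if p: "p \<in> R" for p
  proof -
    have "pv sE p = - g1 p * sE p * sG p" "pu sG p = - g2 p * sE p * sG p"
      using eq1 eq2 p RD by auto
    then show ?thesis
      by (simp add: pu_scaleR pv_scaleR diffR p der algebra_simps)
  qed
  obtain z where z0: "z (u0, v0) = p0" and smz: "smooth2_on D0 z"
    and dz: "\<And>p. p \<in> D0 \<Longrightarrow> pu z p = sE p *\<^sub>R X p \<and> pv z p = sG p *\<^sub>R Y p"
    using poincare_square[OF hR h(1) smooth2_on_scaleR[OF oR smER(1) smR(1)]
        smooth2_on_scaleR[OF oR smER(2) smR(2)] closed, of p0] unfolding D0_def by blast
  have xy: "(1 / sE p) *\<^sub>R pu z p = X p" "(1 / sG p) *\<^sub>R pv z p = Y p" if "p \<in> D0" for p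
    using dz[OF that] sEG[of p] that D0R RD by auto
  have frame: "trapped_frame_at z p (sE p) (sG p) (pu sE p) (pv sE p) (pv sG p) (g1 p) (g2 p) (nu p)
      (la p) (mu p) (X p) (Y p) (N p) (M p)" if p: "p \<in> D0" for p
  proof
    have pR: "p \<in> R" and pD: "p \<in> D"
      using p D0R RD by auto
    have c: "pu (pu z) p = pu (\<lambda>p. sE p *\<^sub>R X p) p" "pv (pu z) p = pv (\<lambda>p. sE p *\<^sub>R X p) p"
      "pv (pv z) p = pv (\<lambda>p. sG p *\<^sub>R Y p) p"
      using dz by (auto intro!: pu_cong[OF oD0 _ p] pv_cong[OF oD0 _ p])
    show "pu (pu z) p = pu sE p *\<^sub>R X p + (sE p)\<^sup>2 *\<^sub>R (g1 p *\<^sub>R Y p + (1 + nu p) *\<^sub>R N p)"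
      "pv (pu z) p = pv sE p *\<^sub>R X p + (sE p * sG p) *\<^sub>R (- g2 p *\<^sub>R Y p + la p *\<^sub>R N p + mu p *\<^sub>R M p)"
      "pv (pv z) p = pv sG p *\<^sub>R Y p + (sG p)\<^sup>2 *\<^sub>R (g2 p *\<^sub>R X p + (1 - nu p) *\<^sub>R N p)"
      unfolding c by (simp_all add: pu_scaleR pv_scaleR diffR pR der power2_eq_square)
  qed (use p D0R RD sEG mu0 dz gram in blast)+
  \<comment> \<open>The formulas are written with all abbreviations expanded, so that after
    \<open>Let_def\<close> is unfolded and the normal fields of a competitor are obtained, this fact
    resolves with the remaining goal.\<close>
  have uniq: "z' p = z p"
    if der': "\<forall>p\<in>D0.
        (1 / sE p) *\<^sub>R pu (\<lambda>p. (1 / sE p) *\<^sub>R pu z' p) p = g1 p *\<^sub>R (1 / sG p) *\<^sub>R pv z' p + (1 + nu p) *\<^sub>R n1 p \<and>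
        (1 / sE p) *\<^sub>R pu (\<lambda>p. (1 / sG p) *\<^sub>R pv z' p) p
          = - g1 p *\<^sub>R (1 / sE p) *\<^sub>R pu z' p + la p *\<^sub>R n1 p + mu p *\<^sub>R n2 p \<and>
        (1 / sG p) *\<^sub>R pv (\<lambda>p. (1 / sE p) *\<^sub>R pu z' p) p
          = - g2 p *\<^sub>R (1 / sG p) *\<^sub>R pv z' p + la p *\<^sub>R n1 p + mu p *\<^sub>R n2 p \<and>
        (1 / sG p) *\<^sub>R pv (\<lambda>p. (1 / sG p) *\<^sub>R pv z' p) p = g2 p *\<^sub>R (1 / sE p) *\<^sub>R pu z' p + (1 - nu p) *\<^sub>R n1 p \<and>
        (1 / sE p) *\<^sub>R pu n1 p = mu p *\<^sub>R (1 / sG p) *\<^sub>R pv z' p + b1 p *\<^sub>R n1 p \<and>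
        (1 / sG p) *\<^sub>R pv n1 p = mu p *\<^sub>R (1 / sE p) *\<^sub>R pu z' p + b2 p *\<^sub>R n1 p \<and>
        (1 / sE p) *\<^sub>R pu n2 p
          = (1 + nu p) *\<^sub>R (1 / sE p) *\<^sub>R pu z' p + la p *\<^sub>R (1 / sG p) *\<^sub>R pv z' p - b1 p *\<^sub>R n2 p \<and>
        (1 / sG p) *\<^sub>R pv n2 p
          = la p *\<^sub>R (1 / sE p) *\<^sub>R pu z' p + (1 - nu p) *\<^sub>R (1 / sG p) *\<^sub>R pv z' p - b2 p *\<^sub>R n2 p"
      and mt': "marginally_trapped_on D0 z'" and smn: "smooth2_on D0 n1" "smooth2_on D0 n2" and z0': "z' (u0, v0) = p0"
      and init: "(1 / sE (u0, v0)) *\<^sub>R pu z' (u0, v0) = x0" "(1 / sG (u0, v0)) *\<^sub>R pv z' (u0, v0) = y0"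
        "n1 (u0, v0) = n10" "n2 (u0, v0) = n20"
      and p: "p \<in> D0" for z' n1 n2 p
  proof -
    have sm': "smooth2_on D0 z'" "smooth2_on D0 n1" "smooth2_on D0 n2"
      using mt' smn by (simp_all only: marginally_trapped_on_def)
    define X' where "X' p = (1 / sE p) *\<^sub>R pu z' p" for p
    define Y' where "Y' p = (1 / sG p) *\<^sub>R pv z' p" for p
    define G :: "real \<times> real \<Rightarrow> real^4^4" where "G p = vector [X' p, Y' p, n1 p, n2 p]" for p
    have inv: "smooth2_on D0 (\<lambda>p. 1 / sE p)" "smooth2_on D0 (\<lambda>p. 1 / sG p)"
    proof -
      have nz: "sE q \<noteq> 0" "sG q \<noteq> 0" if "q \<in> D0" for q
        using sEG[of q] that D0R RD by auto
      show "smooth2_on D0 (\<lambda>p. 1 / sE p)"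
        by (rule smooth2_on_divide[OF oD0 smooth2_on_const smooth2_on_subset[OF smER(1) D0R] nz(1)])
      show "smooth2_on D0 (\<lambda>p. 1 / sG p)"
        by (rule smooth2_on_divide[OF oD0 smooth2_on_const smooth2_on_subset[OF smER(2) D0R] nz(2)])
    qed
    have "smooth2_on D0 X'" "smooth2_on D0 Y'"
      unfolding X'_def Y'_def by (intro smooth2_on_scaleR oD0 inv smooth2_on_pu smooth2_on_pv sm')+
    then have smG': "smooth2_on D0 G"
      unfolding G_def by (intro smooth2_on_vector_4 oD0 sm')
    have scale: "v = s *\<^sub>R w" if "(1 / s) *\<^sub>R v = w" "s > 0" for s and v w :: "real^4"
      using that by auto
    have dG: "G differentiable (at q) \<and> pu G q = A q ** G q \<and> pv G q = B q ** G q" if q: "q \<in> D0" for q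
    proof -
      have s: "sE q > 0" "sG q > 0"
        using sEG[of q] q D0R RD by auto
      have d: "G differentiable (at q)"
        by (rule smooth2_on_differentiable[OF smG' q])
      note d' = bspec[OF der' q, folded X'_def Y'_def]
      have "pu G q $ i = (A q ** G q) $ i" "pv G q $ i = (B q ** G q) $ i" for i
        unfolding pu_vec_nth[OF d] pv_vec_nth[OF d] A_def B_def
        using exhaust_4[of i] d' s
        by (auto simp: coeff_mul_frame G_def vector_4 intro!: scale)
      then show ?thesis
        using d by (simp add: vec_eq_iff)
    qed
    have dF': "F differentiable (at q) \<and> pu F q = A q ** F q \<and> pv F q = B q ** F q" if "q \<in> D0" for q
      using diffF dF that D0R by blast
    have G0: "G (u0, v0) = F (u0, v0)"
      by (simp add: G_def F0 W_def X'_def Y'_def init)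
    \<comment> \<open>The competing frame solves the same system with the same initial rows, hence
      the tangent vectors of the two surfaces agree.\<close>
    have GF: "G q = F q" if "q \<in> D0" for q
      by (rule linear_system_unique[of "u0-h" "u0+h" "v0-h" "v0+h" A B G F "(u0, v0)"])
         (use con hD dG dF' G0 p0D0 that in \<open>auto simp: D0_def[symmetric] intro: continuous_on_subset\<close>)
    have grad: "pu z' q = pu z q" "pv z' q = pv z q" if q: "q \<in> D0" for q
    proof -
      have s: "sE q > 0" "sG q > 0"
        using sEG[of q] q D0R RD by auto
      have "X' q = X q" "Y' q = Y q"
        using arg_cong[OF GF[OF q], of "\<lambda>w. w $ 1"] arg_cong[OF GF[OF q], of "\<lambda>w. w $ 2"]
        by (simp_all add: G_def vector_4 XYNM)
      then show "pu z' q = pu z q" "pv z' q = pv z q"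
        using dz[OF q] s by (auto simp: X'_def Y'_def intro!: scale)
    qed
    \<comment> \<open>Equal gradients give the constant 0 in the Gronwall bound, and both surfaces
      pass through \<open>p0\<close>.\<close>
    have "z' p - z p = 0"
    proof (rule zero_of_partials_bounded[of "u0-h" "u0+h" "v0-h" "v0+h" "\<lambda>p. z' p - z p" 0 "(u0, v0)" p])
      fix q assume "q \<in> {u0-h<..<u0+h} \<times> {v0-h<..<v0+h}"
      then have q: "q \<in> D0"
        by (simp add: D0_def)
      note d = smooth2_on_differentiable[OF sm'(1) q] smooth2_on_differentiable[OF smz q]
      show "(\<lambda>p. z' p - z p) differentiable (at q)"
        by (rule differentiable_diff[OF d])
      show "norm (pu (\<lambda>p. z' p - z p) q) \<le> 0 * norm (z' q - z q)"
        "norm (pv (\<lambda>p. z' p - z p) q) \<le> 0 * norm (z' q - z q)"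
        by (simp_all add: pu_diff[OF d] pv_diff[OF d] grad[OF q])
    qed (use p p0D0 z0 z0' in \<open>simp_all add: D0_def\<close>)
    then show ?thesis
      by simp
  qed
  have mt: "marginally_trapped_on D0 z"
    unfolding marginally_trapped_on_def spacelike_on_def
  proof (intro conjI ballI smz)
    fix p assume p: "p \<in> D0"
    interpret trapped_frame_at z p "sE p" "sG p" "pu sE p" "pv sE p" "pv sG p" "g1 p" "g2 p" "nu p"
      "la p" "mu p" "X p" "Y p" "N p" "M p"
      by (rule frame[OF p])
    show "fE z p > 0" "fE z p * fG z p - (fF z p)\<^sup>2 > 0" "meanH z p \<noteq> 0" "mink (meanH z p) (meanH z p) = 0"
      using pos normal_nonzero gram by (simp_all add: first_form meanH)
  qed
  have flat: "\<forall>p\<in>D0. \<not> flat_point z p"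
    using trapped_frame_at.not_flat[OF frame] by blast
  have metric: "\<forall>p\<in>D0. fE z p = (sE p)\<^sup>2 \<and> fG z p = (sG p)\<^sup>2 \<and> fF z p = 0"
    using trapped_frame_at.first_form[OF frame] by blast
  have geo: "geometric_frame_on D0 z (\<lambda>p. (1 / sE p) *\<^sub>R pu z p) (\<lambda>p. (1 / sG p) *\<^sub>R pv z p) N M"
    unfolding geometric_frame_on_def
  proof
    fix p assume p: "p \<in> D0"
    interpret trapped_frame_at z p "sE p" "sG p" "pu sE p" "pv sE p" "pv sG p" "g1 p" "g2 p" "nu p"
      "la p" "mu p" "X p" "Y p" "N p" "M p"
      by (rule frame[OF p])
    have "X p = (1 / sE p) *\<^sub>R pu z p + 0 *\<^sub>R pv z p" "Y p = 0 *\<^sub>R pu z p + (1 / sG p) *\<^sub>R pv z p"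
      using pos by (simp_all add: zu zv)
    then have "is_tangent z p (X p)" "is_tangent z p (Y p)"
      unfolding is_tangent_def by blast+
    moreover have "is_normal z p (M p)"
      by (simp add: is_normal_def zu zv gram)
    ultimately show "is_tangent z p ((1 / sE p) *\<^sub>R pu z p) \<and> is_tangent z p ((1 / sG p) *\<^sub>R pv z p) \<and>
      mink ((1 / sE p) *\<^sub>R pu z p) ((1 / sE p) *\<^sub>R pu z p) = 1 \<and>
      mink ((1 / sG p) *\<^sub>R pv z p) ((1 / sG p) *\<^sub>R pv z p) = 1 \<and>
      mink ((1 / sE p) *\<^sub>R pu z p) ((1 / sG p) *\<^sub>R pv z p) = 0 \<and>
      (\<exists>c. sff z p ((1 / sE p) *\<^sub>R pu z p) ((1 / sE p) *\<^sub>R pu z p) = c *\<^sub>R meanH z p) \<and>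
      (\<exists>c. sff z p ((1 / sG p) *\<^sub>R pv z p) ((1 / sG p) *\<^sub>R pv z p) = c *\<^sub>R meanH z p) \<and>
      N p = meanH z p \<and> is_normal z p (M p) \<and> mink (M p) (M p) = 0 \<and> mink (N p) (M p) = - 1"
      unfolding xy[OF p] meanH using gram sff by blast
  qed
  have init: "(1 / sE (u0, v0)) *\<^sub>R pu z (u0, v0) = x0" "(1 / sG (u0, v0)) *\<^sub>R pv z (u0, v0) = y0"
    "N (u0, v0) = n10" "M (u0, v0) = n20"
    unfolding xy[OF p0D0] by (simp_all add: XYNM F0 W_def vector_4)
  have derz: "(1 / sE p) *\<^sub>R pu (\<lambda>p. (1 / sE p) *\<^sub>R pu z p) p = g1 p *\<^sub>R Y p + (1 + nu p) *\<^sub>R N p"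
    "(1 / sE p) *\<^sub>R pu (\<lambda>p. (1 / sG p) *\<^sub>R pv z p) p = - g1 p *\<^sub>R X p + la p *\<^sub>R N p + mu p *\<^sub>R M p"
    "(1 / sG p) *\<^sub>R pv (\<lambda>p. (1 / sE p) *\<^sub>R pu z p) p = - g2 p *\<^sub>R Y p + la p *\<^sub>R N p + mu p *\<^sub>R M p"
    "(1 / sG p) *\<^sub>R pv (\<lambda>p. (1 / sG p) *\<^sub>R pv z p) p = g2 p *\<^sub>R X p + (1 - nu p) *\<^sub>R N p"
    "(1 / sE p) *\<^sub>R pu N p = mu p *\<^sub>R Y p + b1 p *\<^sub>R N p"
    "(1 / sG p) *\<^sub>R pv N p = mu p *\<^sub>R X p + b2 p *\<^sub>R N p"
    "(1 / sE p) *\<^sub>R pu M p = (1 + nu p) *\<^sub>R X p + la p *\<^sub>R Y p - b1 p *\<^sub>R M p"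
    "(1 / sG p) *\<^sub>R pv M p = la p *\<^sub>R X p + (1 - nu p) *\<^sub>R Y p - b2 p *\<^sub>R M p"
    if p: "p \<in> D0" for p
  proof -
    have s: "sE p \<noteq> 0" "sG p \<noteq> 0"
      using sEG[of p] p D0R RD by auto
    have pR: "p \<in> R"
      using p D0R by blast
    \<comment> \<open>The normalized derivatives of \<open>z\<close> coincide with \<open>X\<close>
      and \<open>Y\<close> on the open set \<open>D0\<close>, which suffices to exchange them under
      a derivative.\<close>
    have c: "pu (\<lambda>p. (1 / sE p) *\<^sub>R pu z p) p = pu X p" "pv (\<lambda>p. (1 / sE p) *\<^sub>R pu z p) p = pv X p"
      "pu (\<lambda>p. (1 / sG p) *\<^sub>R pv z p) p = pu Y p" "pv (\<lambda>p. (1 / sG p) *\<^sub>R pv z p) p = pv Y p"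
      using xy by (auto intro!: pu_cong[OF oD0 _ p] pv_cong[OF oD0 _ p])
    show "(1 / sE p) *\<^sub>R pu (\<lambda>p. (1 / sE p) *\<^sub>R pu z p) p = g1 p *\<^sub>R Y p + (1 + nu p) *\<^sub>R N p"
      "(1 / sE p) *\<^sub>R pu (\<lambda>p. (1 / sG p) *\<^sub>R pv z p) p = - g1 p *\<^sub>R X p + la p *\<^sub>R N p + mu p *\<^sub>R M p"
      "(1 / sG p) *\<^sub>R pv (\<lambda>p. (1 / sE p) *\<^sub>R pu z p) p = - g2 p *\<^sub>R Y p + la p *\<^sub>R N p + mu p *\<^sub>R M p"
      "(1 / sG p) *\<^sub>R pv (\<lambda>p. (1 / sG p) *\<^sub>R pv z p) p = g2 p *\<^sub>R X p + (1 - nu p) *\<^sub>R N p"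
      "(1 / sE p) *\<^sub>R pu N p = mu p *\<^sub>R Y p + b1 p *\<^sub>R N p"
      "(1 / sG p) *\<^sub>R pv N p = mu p *\<^sub>R X p + b2 p *\<^sub>R N p"
      "(1 / sE p) *\<^sub>R pu M p = (1 + nu p) *\<^sub>R X p + la p *\<^sub>R Y p - b1 p *\<^sub>R M p"
      "(1 / sG p) *\<^sub>R pv M p = la p *\<^sub>R X p + (1 - nu p) *\<^sub>R Y p - b2 p *\<^sub>R M p"
      unfolding c der[OF pR] using s by simp_all
  qed
  have smD0: "smooth2_on D0 N" "smooth2_on D0 M"
    using smR(3,4) D0R by (auto intro: smooth2_on_subset)
  have "connected D0" "D0 \<noteq> {}"
    using p0D0 by (auto simp: D0_def intro!: convex_connected convex_Times)
  then have dom0: "domain2 D0"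
    using oD0 by (simp add: domain2_def)
  have D0D: "D0 \<subseteq> D"
    using D0R RD by blast
  show ?thesis
    unfolding Let_def
    apply (rule exI[of _ D0], intro conjI dom0 D0D p0D0, rule exI[of _ z], rule conjI)
    subgoal
      by (intro conjI mt flat z0 metric exI[of _ N] exI[of _ M] ballI smD0 geo init; simp only: derz xy)
    subgoal
      by (intro allI impI ballI) (elim conjE exE, rule uniq)
    done
qed

end
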